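(* Let $n\ge 1$ and let $K,L\subseteq\mathbb{R}^n$ be convex bodies with $0\in\mathrm{int}\,K\cap\mathrm{int}\,L$ such that $K^\circ$ and $L^\circ$ have opposite barycenters, i.e. $\frac{1}{|K^\circ|}\int_{K^\circ}x\,dx=-\frac{1}{|L^\circ|}\int_{L^\circ}x\,dx$. Then for any $p\in[1,\infty]$ $$ |(K\cap_p L)^\circ|\,|(K+_p(-L))^\circ|\geq\frac{\Gamma\left(1+\frac{n}{p}\right)^2}{\Gamma\left(1+\frac{2n}{p}\right)}|K^\circ|\,|L^\circ|, $$ where for $p=\infty$ one sets $\frac{n}{p}=\frac{2n}{p}=0$.
   Context: A convex body in $\mathbb{R}^n$ is a convex compact set with non-empty interior; $|\cdot|$ is Lebesgue measure; $-L=\{-y:y\in L\}$; $\Gamma$ is the Gamma function. For a convex body $K$ with $0\in\mathrm{int}\,K$, the polar body is $K^\circ=\{x\in\mathbb{R}^n:\langle x,y\rangle\le 1\ \forall y\in K\}$ and the support function is $h_K(x)=\max_{y\in K}\langle x,y\rangle$. For convex bodies $K,L$ with $0$ in their interiors, the $\ell_p$-sum $K+_pL$ is the convex body with support function $$h_{K+_pL}(x)=\left(h_K^p(x)+h_L^p(x)\right)^{1/p}\ (1\le p<\infty),\qquad h_{K+_\infty L}(x)=\max\{h_K(x),h_L(x)\},$$ and the $\ell_p$-intersection $K\cap_pL$ is the convex body with support function $$h_{K\cap_pL}(x)=\inf_{x_1+x_2=x}\left(h_K^p(x_1)+h_L^p(x_2)\right)^{1/p}\ (1\le p<\infty),\qquad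 h_{K\cap_\infty L}(x)=\inf_{x_1+x_2=x}\max\{h_K(x_1),h_L(x_2)\}.$$ *)

theory Defs
  imports "HOL-Analysis.Analysis"
begin

definition convex_body :: "(real ^ 'n) set \<Rightarrow> bool" where
  "convex_body K \<longleftrightarrow> convex K \<and> compact K \<and> interior K \<noteq> {}"

definition polar_body :: "(real ^ 'n) set \<Rightarrow> (real ^ 'n) set" where
  "polar_body K = {x. \<forall>y\<in>K. x \<bullet> y \<le> 1}"

text \<open>For a convex body the supremum is a maximum, by compactness.\<close>

definition support_function :: "(real ^ 'n) set \<Rightarrow> real ^ 'n \<Rightarrow> real" where
  "support_function K x = (SUP y\<in>K. x \<bullet> y)"

text \<open>
  A convex body is determined by its support function, so the description below has at most
  one solution; it has one for the two functions to which it is applied, because for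
  convex bodies with 0 in their interiors these are sublinear and positive away from 0.
\<close>

definition body_with_support :: "(real ^ 'n \<Rightarrow> real) \<Rightarrow> (real ^ 'n) set" where
  "body_with_support h = (THE M. convex_body M \<and> (\<forall>x. support_function M x = h x))"

text \<open>
  The exponent ranges over the extended reals in order to include infinity. The function is only
  applied to nonnegative \<open>a\<close> and \<open>b\<close>, and 0 powr \<open>p\<close> = 0 for every \<open>p\<close>.
\<close>

definition lp_combination :: "ereal \<Rightarrow> real \<Rightarrow> real \<Rightarrow> real" where
  "lp_combination p a b =
     (if p = \<infinity> then max a b
      else (a powr real_of_ereal p + b powr real_of_ereal p) powr (1 / real_of_ereal p))"

definition lp_sum :: "ereal \<Rightarrow> (real ^ 'n) set \<Rightarrow> (real ^ 'n) set \<Rightarrow> (real ^ 'n) set" where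
  "lp_sum p K L =
     body_with_support (\<lambda>x. lp_combination p (support_function K x) (support_function L x))"

definition lp_intersection :: "ereal \<Rightarrow> (real ^ 'n) set \<Rightarrow> (real ^ 'n) set \<Rightarrow> (real ^ 'n) set" where
  "lp_intersection p K L =
     body_with_support (\<lambda>x. Inf {lp_combination p (support_function K x1) (support_function L x2)
                                 | x1 x2. x1 + x2 = x})"

definition barycenter :: "(real ^ 'n) set \<Rightarrow> real ^ 'n" where
  "barycenter K = (1 / measure lebesgue K) *\<^sub>R (LINT x:K|lebesgue. x)"

text \<open>The quotient \<open>a / p\<close>, with the convention that it is 0 for infinite \<open>p\<close>.\<close>

definition over_exponent :: "real \<Rightarrow> ereal \<Rightarrow> real" where
  "over_exponent a p = (if p = \<infinity> then 0 else a / real_of_ereal p)"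

end

theory Submission
  imports Defs "HOL-Probability.Distribution_Functions"
begin

text \<open>
  Let \<open>f\<close> and \<open>g\<close> be the support functions of \<open>K\<close> and \<open>L\<close>, i.e. the gauges of the polar bodies,
  and let \<open>D\<close> be the unit ball of the gauge \<open>N (x, y) = (f x ^ p + g y ^ p) ^ (1 / p)\<close> on the product
  space. The polar of the intersection contains the image of \<open>D\<close> under \<open>(x, y) \<mapsto> x + y\<close>, and the polar of the
  sum is the fiber of \<open>D\<close> over 0 under this map. By the Brunn-Minkowski inequality the volume
  \<open>F z\<close> of the fiber over \<open>z\<close> is log-concave, so \<open>F z \<le> F 0 * exp (c \<bullet> z)\<close> for some \<open>c\<close>, whence
  \<open>F z * (1 - c \<bullet> z) \<le> F 0\<close>. Integrating over the image, where the linear term vanishes because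
  the barycenters are opposite, gives \<open>vol D \<le> F 0 * vol (image)\<close>. The volume and the first moments of \<open>D\<close> are
  obtained by integrating homogeneous functions against \<open>exp (- N ^ p)\<close>, which factorizes.
\<close>

section \<open>The multiplicative Brunn-Minkowski inequality\<close>

text \<open>The supergradient pays for this with a linear term whose coefficient \<open>c\<close> is
  not known, and centering removes that term whatever \<open>c\<close> is. Centering comes from the
  product structure: the moment of \<open>c \<bullet> (x + y)\<close> over \<open>D\<close> is a
  common factor times \<open>c \<bullet> (a + b)\<close>, where \<open>a\<close> and
  \<open>b\<close> are the barycenters of the polar bodies, and the factor is common because both
  bodies have the same dimension. The constant of the theorem is exactly the ratio of the volume of
  \<open>D\<close> to the product of the volumes of the polar bodies. For infinite \<open>p\<close>
  the ball \<open>D\<close> is the product of the polar bodies, the constant is 1, and the statement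
  is the Milman-Pajor inequality for a Minkowski sum and an intersection.\<close>

lemma null_hyperplane:
  assumes "i \<in> Basis"
  shows "{x::'a::euclidean_space. x \<bullet> i = t} \<in> null_sets lborel"
proof -
  have "{x::'a. x \<bullet> i = t} \<in> null_sets lebesgue"
    using negligible_standard_hyperplane[OF assms] by (simp add: negligible_iff_null_sets)
  moreover have "{x::'a. x \<bullet> i = t} \<in> sets lborel"
    by measurable
  ultimately show ?thesis
    by (simp add: null_sets_completion_iff)
qed

lemma fmeasurable_lborelI:
  "S \<in> sets borel \<Longrightarrow> bounded S \<Longrightarrow> S \<in> fmeasurable lborel"
  by (auto intro!: fmeasurableI emeasure_bounded_finite)

lemma measure_hyperplane_split:
  fixes S :: "'a::euclidean_space set"
  assumes S: "S \<in> fmeasurable lborel" and i: "i \<in> Basis"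
  shows "measure lborel S
    = measure lborel (S \<inter> {x. x \<bullet> i < t}) + measure lborel (S \<inter> {x. t < x \<bullet> i})"
proof -
  have [measurable]: "S \<in> sets borel"
    using S by auto
  have "measure lborel S = measure lborel (S - {x. x \<bullet> i = t})"
    using null_hyperplane[OF i] by (intro measure_Diff_null_set[symmetric]) auto
  also have "S - {x. x \<bullet> i = t} = (S \<inter> {x. x \<bullet> i < t}) \<union> (S \<inter> {x. t < x \<bullet> i})"
    by auto
  also have "measure lborel \<dots>
    = measure lborel (S \<inter> {x. x \<bullet> i < t}) + measure lborel (S \<inter> {x. t < x \<bullet> i})"
    by (rule measure_Un_AE) (auto intro!: fmeasurable_Int_fmeasurable S)
  finally show ?thesis .
qed

text \<open>The volume to the left of a moving hyperplane is the distribution function of a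
  coordinate. It is continuous since hyperplanes are null, with limits 0 and the whole volume, so
  every intermediate ratio occurs.\<close>

lemma exists_hyperplane_cut:
  fixes S :: "'a::euclidean_space set"
  assumes S: "S \<in> fmeasurable lborel" and i: "i \<in> Basis" and \<theta>: "0 < \<theta>" "\<theta> < 1"
  obtains s where "measure lborel (S \<inter> {x. x \<bullet> i < s}) = \<theta> * measure lborel S"
proof (cases "measure lborel S = 0")
  case True
  have "measure lborel (S \<inter> {x. x \<bullet> i < 0}) \<le> measure lborel S"
    using S by (intro measure_mono_fmeasurable) auto
  with True that[of 0] show ?thesis
    by (simp add: measure_le_0_iff)
next
  case False
  then have pos: "measure lborel S > 0"
    by (simp add: zero_less_measure_iff)
  have [measurable]: "S \<in> sets borel"
    using S by auto
  define M where "M = distr (restrict_space lborel S) borel (\<lambda>x. x \<bullet> i)"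
  have [measurable]: "(\<lambda>x. x \<bullet> i) \<in> restrict_space lborel S \<rightarrow>\<^sub>M borel"
    by (intro measurable_restrict_space1) measurable
  have meas: "measure M X = measure lborel (S \<inter> {x. x \<bullet> i \<in> X})" if "X \<in> sets borel" for X
  proof -
    have "measure M X = measure (restrict_space lborel S) (S \<inter> {x. x \<bullet> i \<in> X})"
      unfolding M_def using that
      by (subst measure_distr) (auto simp: space_restrict_space vimage_def Int_def conj_commute)
    also have "\<dots> = measure lborel (S \<inter> {x. x \<bullet> i \<in> X})"
      by (rule measure_restrict_space) auto
    finally show ?thesis .
  qed
  have "finite_measure (restrict_space lborel S)"
    using S by (intro finite_measureI) (auto simp: fmeasurable_def emeasure_restrict_space space_restrict_space)
  then interpret finite_borel_measure M
    unfolding finite_borel_measure_def finite_borel_measure_axioms_def M_def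
    by (auto intro!: finite_measure.finite_measure_distr)
  have null: "measure lborel (S \<inter> {x. x \<bullet> i = s}) = 0" for s
    using null_hyperplane[OF i, of s]
    by (metis Int_commute \<open>S \<in> sets borel\<close> measure_eq_0_null_sets null_set_Int1 sets_lborel)
  then have "isCont (cdf M) x" for x
    by (simp add: isCont_cdf meas)
  moreover have "measure M (space M) = measure lborel S"
    using meas[of UNIV] by (simp add: borel_UNIV)
  then have "\<forall>\<^sub>F x in at_top. \<theta> * measure lborel S < cdf M x"
    using cdf_lim_at_top \<theta> pos by (intro order_tendstoD(1)) auto
  then obtain b where b: "\<And>x. x \<ge> b \<Longrightarrow> \<theta> * measure lborel S < cdf M x"
    by (auto simp: eventually_at_top_linorder)
  have "\<forall>\<^sub>F x in at_bot. cdf M x < \<theta> * measure lborel S"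
    using cdf_lim_at_bot \<theta> pos by (intro order_tendstoD(2)) auto
  then obtain a where a: "\<And>x. x \<le> a \<Longrightarrow> cdf M x < \<theta> * measure lborel S"
    by (auto simp: eventually_at_bot_linorder)
  have "a \<le> b"
    using a[of a] b[of a] by linarith
  ultimately obtain s where "cdf M s = \<theta> * measure lborel S"
    using IVT[of "cdf M" a "\<theta> * measure lborel S" b] a[of a] b[of b] by (auto intro: less_imp_le)
  then have s: "measure lborel (S \<inter> {x. x \<bullet> i \<le> s}) = \<theta> * measure lborel S"
    by (simp add: cdf_def meas)
  \<comment> \<open>The distribution function measures closed half-spaces; splitting along the same
    hyperplane shows that the open one has the same volume.\<close>
  have "measure lborel (S \<inter> {x. x \<bullet> i \<le> s})
    = measure lborel (S \<inter> {x. x \<bullet> i \<le> s} \<inter> {x. x \<bullet> i < s})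
      + measure lborel (S \<inter> {x. x \<bullet> i \<le> s} \<inter> {x. s < x \<bullet> i})"
    by (intro measure_hyperplane_split i fmeasurable_Int_fmeasurable S) auto
  also have "S \<inter> {x. x \<bullet> i \<le> s} \<inter> {x. s < x \<bullet> i} = {}"
    by auto
  also have "S \<inter> {x. x \<bullet> i \<le> s} \<inter> {x. x \<bullet> i < s} = S \<inter> {x. x \<bullet> i < s}"
    by auto
  finally show ?thesis
    using s that by simp
qed

section \<open>Finite families of disjoint open boxes\<close>

text \<open>Boxes are open so that each side of a hyperplane again receives open boxes, and nonempty
  so that a nonempty family has positive volume and its cardinality can serve as induction
  measure.\<close>

definition open_boxes :: "'a::euclidean_space set set \<Rightarrow> bool" where
  "open_boxes D \<longleftrightarrow> finite D \<and> disjoint D \<and> (\<forall>Q\<in>D. Q \<noteq> {} \<and> (\<exists>a b. Q = box a b))"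

lemma box_Int_halfspace:
  fixes a b :: "'a::euclidean_space"
  assumes i: "i \<in> Basis" and H: "H = {x. x \<bullet> i < t} \<or> H = {x. t < x \<bullet> i}"
  shows "\<exists>c d. box a b \<inter> H = box c d"
  using H
proof
  assume "H = {x. x \<bullet> i < t}"
  then have "box a b \<inter> H = box a (\<Sum>j\<in>Basis. (if j = i then min (b \<bullet> i) t else b \<bullet> j) *\<^sub>R j)"
    using i by (auto simp: mem_box split: if_splits)
  then show ?thesis
    by blast
next
  assume "H = {x. t < x \<bullet> i}"
  then have "box a b \<inter> H = box (\<Sum>j\<in>Basis. (if j = i then max (a \<bullet> i) t else a \<bullet> j) *\<^sub>R j) b"
    using i by (auto simp: mem_box split: if_splits)
  then show ?thesis
    by blast
qed

text \<open>Empty pieces are discarded, so a box that misses the half-space lowers the count. This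
  strict decrease drives the Hadwiger-Ohmann induction.\<close>

lemma open_boxes_Int_halfspace:
  fixes D :: "'a::euclidean_space set set"
  assumes D: "open_boxes D" and i: "i \<in> Basis"
    and H: "H = {x. x \<bullet> i < t} \<or> H = {x. t < x \<bullet> i}"
  defines "E \<equiv> (\<lambda>Q. Q \<inter> H) ` D - {{}}"
  shows "open_boxes E" "\<Union>E = \<Union>D \<inter> H" "card E \<le> card D"
    "Q \<in> D \<Longrightarrow> Q \<inter> H = {} \<Longrightarrow> card E < card D"
proof -
  have fin: "finite D"
    using D by (simp add: open_boxes_def)
  have "disjoint E"
    using D unfolding open_boxes_def disjoint_def E_def by auto
  moreover have "\<exists>a b. P = box a b" if "P \<in> E" for P
    using that D box_Int_halfspace[OF i H] unfolding open_boxes_def E_def by fastforce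
  ultimately show "open_boxes E"
    using fin by (auto simp: open_boxes_def E_def)
  show "\<Union>E = \<Union>D \<inter> H"
    by (auto simp: E_def)
  show "card E \<le> card D"
    unfolding E_def by (meson card_Diff1_le card_image_le fin finite_imageI le_trans)
  show "card E < card D" if "Q \<in> D" "Q \<inter> H = {}"
  proof -
    have "card E < card ((\<lambda>Q. Q \<inter> H) ` D)"
    proof -
      have "{} \<in> (\<lambda>Q. Q \<inter> H) ` D"
        using that by (metis imageI)
      then show ?thesis
        unfolding E_def using fin by (intro card_Diff1_less) auto
    qed
    also have "\<dots> \<le> card D"
      by (rule card_image_le[OF fin])
    finally show ?thesis .
  qed
qed

lemma open_boxes_Union:
  fixes D :: "'a::euclidean_space set set"
  assumes "open_boxes D"
  shows "open (\<Union>D)" "bounded (\<Union>D)" "\<Union>D \<in> fmeasurable lborel"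
proof -
  have "open Q \<and> bounded Q" if "Q \<in> D" for Q
    using assms that by (metis open_boxes_def open_box bounded_box)
  then show "open (\<Union>D)" and "bounded (\<Union>D)"
    using assms by (auto simp: open_boxes_def)
  then show "\<Union>D \<in> fmeasurable lborel"
    by (intro fmeasurable_lborelI) auto
qed

lemma measure_open_pos:
  fixes U :: "'a::euclidean_space set"
  assumes "open U" "U \<noteq> {}" "U \<in> fmeasurable lborel"
  shows "0 < measure lborel U"
proof -
  obtain x where "x \<in> U"
    using assms by auto
  then obtain e where e: "e > 0" "ball x e \<subseteq> U"
    using assms openE by blast
  have "0 < measure lborel (ball x e)"
    using content_ball_pos[OF e(1)] by simp
  also have "\<dots> \<le> measure lborel U"
    using e assms by (intro measure_mono_fmeasurable) auto
  finally show ?thesis .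
qed

section \<open>Brunn-Minkowski for unions of boxes\<close>

text \<open>\<open>C\<close> ranges over all measurable sets of finite volume that contain the
  combinations. This avoids the measurability of the Minkowski sum and allows \<open>C\<close> to be
  cut by half-spaces. As \<open>0 powr u = 0\<close>, the condition is trivial when \<open>A\<close>
  or \<open>B\<close> is null.\<close>

definition brunn_minkowski :: "real \<Rightarrow> real \<Rightarrow> 'a::euclidean_space set \<Rightarrow> 'a set \<Rightarrow> bool" where
  "brunn_minkowski u v A B \<longleftrightarrow>
     (\<forall>C\<in>fmeasurable lborel. (\<forall>x\<in>A. \<forall>y\<in>B. u *\<^sub>R x + v *\<^sub>R y \<in> C)
        \<longrightarrow> measure lborel A powr u * measure lborel B powr v \<le> measure lborel C)"

lemma brunn_minkowski_commute: "brunn_minkowski u v A B \<longleftrightarrow> brunn_minkowski v u B A"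
  unfolding brunn_minkowski_def by (metis add.commute mult.commute)

text \<open>The box with the combined corners lies in \<open>C\<close>, and its side lengths are
  weighted arithmetic means. Weighted AM-GM in every coordinate, multiplied up, bounds its volume
  from below.\<close>

lemma brunn_minkowski_box:
  fixes a b c d :: "'a::euclidean_space"
  assumes u: "0 < u" "0 < v" "u + v = 1" and ne: "box a b \<noteq> {}" "box c d \<noteq> {}"
  shows "brunn_minkowski u v (box a b) (box c d)"
  unfolding brunn_minkowski_def
proof (intro ballI impI)
  fix C :: "'a set"
  assume C: "C \<in> fmeasurable lborel" and sub: "\<forall>x\<in>box a b. \<forall>y\<in>box c d. u *\<^sub>R x + v *\<^sub>R y \<in> C"
  define l where "l = u *\<^sub>R a + v *\<^sub>R c"
  define w where "w = u *\<^sub>R b + v *\<^sub>R d"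
  have ab: "a \<bullet> i < b \<bullet> i" "c \<bullet> i < d \<bullet> i" if "i \<in> Basis" for i
    using ne that by (auto simp: box_ne_empty)
  have lw: "l \<bullet> i < w \<bullet> i" if "i \<in> Basis" for i
    unfolding l_def w_def using ab[OF that] u
    by (simp add: inner_simps add_strict_mono)
  have "box l w \<subseteq> C"
  proof
    fix z assume z: "z \<in> box l w"
    \<comment> \<open>The relative position of \<open>z\<close> in the combined box; the points at
      the same relative position in the two boxes combine to \<open>z\<close>.\<close>
    define r where "r i = (z \<bullet> i - l \<bullet> i) / (w \<bullet> i - l \<bullet> i)" for i
    have r: "0 < r i" "r i < 1" "z \<bullet> i = l \<bullet> i + r i * (w \<bullet> i - l \<bullet> i)" if "i \<in> Basis" for i
      using z lw[OF that] that by (auto simp: r_def mem_box)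
    define x where "x = (\<Sum>i\<in>Basis. (a \<bullet> i + r i * (b \<bullet> i - a \<bullet> i)) *\<^sub>R i)"
    define y where "y = (\<Sum>i\<in>Basis. (c \<bullet> i + r i * (d \<bullet> i - c \<bullet> i)) *\<^sub>R i)"
    have between: "s < s + q * (t - s)" "s + q * (t - s) < t" if "s < t" "0 < q" "q < 1" for s t q :: real
      using that mult_strict_right_mono[of q 1 "t - s"] by (auto simp: algebra_simps)
    have "x \<in> box a b" "y \<in> box c d"
      using ab r between by (auto simp: mem_box x_def y_def)
    moreover have "z = u *\<^sub>R x + v *\<^sub>R y"
    proof (rule euclidean_eqI)
      fix i :: 'a assume i: "i \<in> Basis"
      have "x \<bullet> i = a \<bullet> i + r i * (b \<bullet> i - a \<bullet> i)" "y \<bullet> i = c \<bullet> i + r i * (d \<bullet> i - c \<bullet> i)"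
        using i by (simp_all add: x_def y_def)
      then show "z \<bullet> i = (u *\<^sub>R x + v *\<^sub>R y) \<bullet> i"
        using r(3)[OF i] by (simp only: l_def w_def inner_simps) (simp add: algebra_simps)
    qed
    ultimately show "z \<in> C"
      using sub by blast
  qed
  then have "measure lborel (box l w) \<le> measure lborel C"
    using C by (intro measure_mono_fmeasurable) auto
  moreover have "measure lborel (box a b) powr u * measure lborel (box c d) powr v
      \<le> measure lborel (box l w)"
  proof -
    have "measure lborel (box a b) powr u * measure lborel (box c d) powr v
      = (\<Prod>i\<in>Basis. (b \<bullet> i - a \<bullet> i) powr u * (d \<bullet> i - c \<bullet> i) powr v)"
      using ab by (simp add: prod_powr_distrib less_imp_le inner_diff_left prod.distrib)
    also have "\<dots> \<le> (\<Prod>i\<in>Basis. w \<bullet> i - l \<bullet> i)"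
    proof (rule prod_mono)
      fix i :: 'a assume i: "i \<in> Basis"
      have "(b \<bullet> i - a \<bullet> i) powr u * (d \<bullet> i - c \<bullet> i) powr v
          \<le> u * (b \<bullet> i - a \<bullet> i) + v * (d \<bullet> i - c \<bullet> i)"
        using u ab[OF i] by (intro Youngs_inequality_0) auto
      also have "\<dots> = w \<bullet> i - l \<bullet> i"
        by (simp add: l_def w_def inner_simps algebra_simps)
      finally show "0 \<le> (b \<bullet> i - a \<bullet> i) powr u * (d \<bullet> i - c \<bullet> i) powr v
        \<and> (b \<bullet> i - a \<bullet> i) powr u * (d \<bullet> i - c \<bullet> i) powr v \<le> w \<bullet> i - l \<bullet> i"
        by simp
    qed
    also have "\<dots> = measure lborel (box l w)"
      using lw by (simp add: less_imp_le inner_diff_left)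
    finally show ?thesis .
  qed
  ultimately show "measure lborel (box a b) powr u * measure lborel (box c d) powr v
      \<le> measure lborel C"
    by linarith
qed

lemma open_not_subset_hyperplane:
  fixes U :: "'a::euclidean_space set"
  assumes "open U" "U \<noteq> {}" "i \<in> Basis"
  shows "\<not> U \<subseteq> {x. x \<bullet> i = t}"
proof
  assume sub: "U \<subseteq> {x. x \<bullet> i = t}"
  obtain x where "x \<in> U"
    using assms(2) by auto
  then obtain e where x: "x \<in> U" "e > 0" "ball x e \<subseteq> U"
    using assms(1) openE by metis
  have "x + (e / 2) *\<^sub>R i \<in> ball x e"
    using x assms(3) by (simp add: dist_norm)
  then have "(x + (e / 2) *\<^sub>R i) \<bullet> i = x \<bullet> i"
    using sub x by blast
  then show False
    using x assms(3) by (simp add: inner_simps inner_same_Basis)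
qed

text \<open>
  The Hadwiger-Ohmann argument: a hyperplane separates two of the boxes of \<open>A\<close>, and a parallel one
  cuts \<open>B\<close> in the same ratio of volumes; both halves involve fewer boxes.
\<close>

lemma brunn_minkowski_open_boxes_step:
  fixes A B :: "'a::euclidean_space set set"
  assumes u: "0 < u" "0 < v" "u + v = 1"
    and A: "open_boxes A" "2 \<le> card A" and B: "open_boxes B" "B \<noteq> {}"
    and IH: "\<And>A' B' :: 'a set set. \<lbrakk>open_boxes A'; open_boxes B'; A' \<noteq> {}; B' \<noteq> {};
               card A' + card B' < card A + card B\<rbrakk> \<Longrightarrow> brunn_minkowski u v (\<Union>A') (\<Union>B')"
  shows "brunn_minkowski u v (\<Union>A) (\<Union>B)"
  unfolding brunn_minkowski_def
proof (intro ballI impI)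
  fix C :: "'a set"
  assume C: "C \<in> fmeasurable lborel" and sub: "\<forall>x\<in>\<Union>A. \<forall>y\<in>\<Union>B. u *\<^sub>R x + v *\<^sub>R y \<in> C"
 have finA: "finite A"
    using A(1) by (simp add: open_boxes_def)
  obtain P Q where PQ: "P \<in> A" "Q \<in> A" "P \<noteq> Q"
    using finA A(2) card_le_Suc0_iff_eq[of A] by force
  obtain a b c d where P: "P = box a b" and Q: "Q = box c d"
    using PQ A unfolding open_boxes_def by metis
  have PQne: "P \<noteq> {}" "Q \<noteq> {}" and "P \<inter> Q = {}"
    using PQ A by (auto simp: open_boxes_def disjoint_def)
  then obtain i where i: "i \<in> Basis"
    and sep: "b \<bullet> i \<le> c \<bullet> i \<or> d \<bullet> i \<le> a \<bullet> i"
    unfolding P Q disjoint_interval box_ne_empty by (metis linorder_not_le)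
  \<comment> \<open>Which of the two boxes comes first along coordinate \<open>i\<close> is unknown,
    so they are renamed: \<open>P'\<close> has nothing to the right of \<open>t\<close> and
    \<open>Q'\<close> nothing to the left.\<close>
  have "\<exists>P'\<in>A. \<exists>Q'\<in>A. \<exists>t. P' \<inter> {x. t < x \<bullet> i} = {} \<and> Q' \<inter> {x. x \<bullet> i < t} = {}"
    using sep
  proof
    assume "b \<bullet> i \<le> c \<bullet> i"
    then have "P \<inter> {x. b \<bullet> i < x \<bullet> i} = {} \<and> Q \<inter> {x. x \<bullet> i < b \<bullet> i} = {}"
      using i by (fastforce simp: P Q mem_box)
    then show ?thesis
      using PQ by blast
  next
    assume "d \<bullet> i \<le> a \<bullet> i"
    then have "Q \<inter> {x. d \<bullet> i < x \<bullet> i} = {} \<and> P \<inter> {x. x \<bullet> i < d \<bullet> i} = {}"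
      using i by (fastforce simp: P Q mem_box)
    then show ?thesis
      using PQ by blast
  qed
  then obtain P' Q' t where P': "P' \<in> A" "P' \<inter> {x. t < x \<bullet> i} = {}"
    and Q': "Q' \<in> A" "Q' \<inter> {x. x \<bullet> i < t} = {}"
    by blast
  have meas_pos: "0 < measure lborel (\<Union>D)" if "open_boxes D" "D \<noteq> {}" for D :: "'a set set"
    using that by (intro measure_open_pos open_boxes_Union) (auto simp: open_boxes_def)
  have ne_if_pos: "D \<noteq> {}" if "0 < measure lborel (\<Union>D)" for D :: "'a set set"
    using that by auto
  define H1 where "H1 s = {x. x \<bullet> i < s}" for s
  define H2 where "H2 s = {x. s < x \<bullet> i}" for s
  define cut where "cut H D = (\<lambda>Q. Q \<inter> H) ` D - {{}}" for H :: "'a set" and D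
  have H: "H1 s = {x. x \<bullet> i < s} \<or> H1 s = {x. s < x \<bullet> i}"
    "H2 s = {x. x \<bullet> i < s} \<or> H2 s = {x. s < x \<bullet> i}" for s
    by (auto simp: H1_def H2_def)
  note cut1 = open_boxes_Int_halfspace[OF _ i H(1), folded cut_def]
  note cut2 = open_boxes_Int_halfspace[OF _ i H(2), folded cut_def]
  define \<alpha> where "\<alpha> = measure lborel (\<Union>A)"
  define \<beta> where "\<beta> = measure lborel (\<Union>B)"
  define \<theta> where "\<theta> = measure lborel (\<Union>(cut (H1 t) A)) / \<alpha>"
  have \<alpha>: "0 < \<alpha>" and \<beta>: "0 < \<beta>"
    unfolding \<alpha>_def \<beta>_def using A B by (auto intro!: meas_pos)
  have split: "measure lborel (\<Union>D)
      = measure lborel (\<Union>(cut (H1 s) D)) + measure lborel (\<Union>(cut (H2 s) D))"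
    if "open_boxes D" for D s
    using measure_hyperplane_split[OF open_boxes_Union(3)[OF that] i, of s] that
    by (simp add: cut1(2) cut2(2) flip: H1_def H2_def)
  have "P' \<noteq> {}" "Q' \<noteq> {}"
    using P' Q' A by (auto simp: open_boxes_def)
  \<comment> \<open>An open box is not contained in a hyperplane, so \<open>P'\<close> leaves
    positive volume on the left. With the same argument for \<open>Q'\<close> on the right, \<theta>
    lies strictly between 0 and 1.\<close>
  have "P' \<inter> H1 t \<noteq> {}"
  proof
    assume "P' \<inter> H1 t = {}"
    then have "P' \<subseteq> {x. x \<bullet> i = t}"
      using P' by (force simp: H1_def)
    moreover have "open P'"
      using P' A unfolding open_boxes_def by (metis open_box)
    ultimately show False
      using \<open>P' \<noteq> {}\<close> open_not_subset_hyperplane[OF _ _ i] by blast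
  qed
  then have A1: "0 < measure lborel (\<Union>(cut (H1 t) A))"
    using P' A by (intro meas_pos cut1(1)) (auto simp: cut_def)
  have "Q' \<inter> H2 t \<noteq> {}"
  proof
    assume "Q' \<inter> H2 t = {}"
    then have "Q' \<subseteq> {x. x \<bullet> i = t}"
      using Q' by (force simp: H2_def)
    moreover have "open Q'"
      using Q' A unfolding open_boxes_def by (metis open_box)
    ultimately show False
      using \<open>Q' \<noteq> {}\<close> open_not_subset_hyperplane[OF _ _ i] by blast
  qed
  then have A2: "0 < measure lborel (\<Union>(cut (H2 t) A))"
    using Q' A by (intro meas_pos cut2(1)) (auto simp: cut_def)
  have \<theta>: "0 < \<theta>" "\<theta> < 1"
    using A1 A2 split[OF A(1), of t] \<alpha> by (auto simp: \<theta>_def \<alpha>_def)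
  have \<alpha>1: "measure lborel (\<Union>(cut (H1 t) A)) = \<theta> * \<alpha>"
    using \<alpha> by (simp add: \<theta>_def)
  have \<alpha>2: "measure lborel (\<Union>(cut (H2 t) A)) = (1 - \<theta>) * \<alpha>"
    using split[OF A(1), of t] \<alpha>1 by (simp add: \<alpha>_def algebra_simps)
  obtain s where "measure lborel (\<Union>B \<inter> {x. x \<bullet> i < s}) = \<theta> * \<beta>"
    using exists_hyperplane_cut[OF open_boxes_Union(3)[OF B(1)] i \<theta>] unfolding \<beta>_def by metis
  then have \<beta>1: "measure lborel (\<Union>(cut (H1 s) B)) = \<theta> * \<beta>"
    using B by (simp add: cut1(2) flip: H1_def)
  have \<beta>2: "measure lborel (\<Union>(cut (H2 s) B)) = (1 - \<theta>) * \<beta>"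
    using split[OF B(1), of s] \<beta>1 by (simp add: \<beta>_def algebra_simps)
  \<comment> \<open>Since \<open>u + v = 1\<close>, the bound is homogeneous of degree 1 in the
    common ratio \<open>r\<close>. Cutting \<open>A\<close> and \<open>B\<close> in equal ratios
    therefore lets the two partial bounds add up to the full one.\<close>
  have powr_scale: "(r * \<alpha>) powr u * (r * \<beta>) powr v = r * (\<alpha> powr u * \<beta> powr v)" if "0 < r" for r
  proof -
    have "(r * \<alpha>) powr u * (r * \<beta>) powr v = (r powr u * r powr v) * (\<alpha> powr u * \<beta> powr v)"
      using that \<alpha> \<beta> by (simp add: powr_mult)
    also have "r powr u * r powr v = r"
      using that u by (simp flip: powr_add)
    finally show ?thesis .
  qed
  \<comment> \<open>Combinations of points left of \<open>t\<close> and left of \<open>s\<close> lie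
    left of \<open>m\<close>, and likewise on the right, so the two halves use disjoint parts of
    \<open>C\<close>.\<close>
  define m where "m = u * t + v * s"
  have le: "r * (\<alpha> powr u * \<beta> powr v) \<le> measure lborel (C \<inter> H)"
    if r: "0 < r" and A': "open_boxes A'" "measure lborel (\<Union>A') = r * \<alpha>" "card A' < card A" "\<Union>A' = \<Union>A \<inter> HA"
      and B': "open_boxes B'" "measure lborel (\<Union>B') = r * \<beta>" "card B' \<le> card B" "\<Union>B' = \<Union>B \<inter> HB"
      and H: "H \<in> sets borel" "\<And>x y. x \<in> HA \<Longrightarrow> y \<in> HB \<Longrightarrow> u *\<^sub>R x + v *\<^sub>R y \<in> H"
    for r A' B' H HA HB
  proof -
    have "A' \<noteq> {}" "B' \<noteq> {}"
      using r A'(2) B'(2) \<alpha> \<beta> by auto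
    then have "brunn_minkowski u v (\<Union>A') (\<Union>B')"
      using A' B' by (intro IH) auto
    moreover have "C \<inter> H \<in> fmeasurable lborel"
      using C H by (intro fmeasurable_Int_fmeasurable) auto
    moreover have "u *\<^sub>R x + v *\<^sub>R y \<in> C \<inter> H" if "x \<in> \<Union>A'" "y \<in> \<Union>B'" for x y
      using sub that H(2) unfolding A'(4) B'(4) by blast
    ultimately have "(r * \<alpha>) powr u * (r * \<beta>) powr v \<le> measure lborel (C \<inter> H)"
      unfolding brunn_minkowski_def A'(2)[symmetric] B'(2)[symmetric] by blast
    then show ?thesis
      by (simp only: powr_scale[OF r])
  qed
  have "\<theta> * (\<alpha> powr u * \<beta> powr v) \<le> measure lborel (C \<inter> H1 m)"
    using \<theta> cut1(1,2,4)[OF A(1)] cut1(1,2,3)[OF B(1)] \<alpha>1 \<beta>1 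
  proof (intro le[of \<theta> "cut (H1 t) A" "H1 t" "cut (H1 s) B" "H1 s"])
    \<comment> \<open>\<open>Q'\<close> has no piece on the left and, below, \<open>P'\<close> none
      on the right, so each half of \<open>A\<close> has fewer boxes than \<open>A\<close>, while
      cutting never increases the count for \<open>B\<close>.\<close>
    show "card (cut (H1 t) A) < card A"
      by (rule cut1(4)[OF A(1) Q'(1)]) (use Q' in \<open>simp add: H1_def\<close>)
    show "u *\<^sub>R x + v *\<^sub>R y \<in> H1 m" if "x \<in> H1 t" "y \<in> H1 s" for x y
      using that u by (simp add: H1_def m_def inner_simps add_strict_mono)
  qed (auto simp: H1_def)
  moreover have "(1 - \<theta>) * (\<alpha> powr u * \<beta> powr v) \<le> measure lborel (C \<inter> H2 m)"
    using \<theta> cut2(1,2,4)[OF A(1)] cut2(1,2,3)[OF B(1)] \<alpha>2 \<beta>2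
  proof (intro le[of "1 - \<theta>" "cut (H2 t) A" "H2 t" "cut (H2 s) B" "H2 s"])
    show "card (cut (H2 t) A) < card A"
      by (rule cut2(4)[OF A(1) P'(1)]) (use P' in \<open>simp add: H2_def\<close>)
    show "u *\<^sub>R x + v *\<^sub>R y \<in> H2 m" if "x \<in> H2 t" "y \<in> H2 s" for x y
      using that u by (simp add: H2_def m_def inner_simps add_strict_mono)
  qed (auto simp: H2_def)
  moreover have "measure lborel C = measure lborel (C \<inter> H1 m) + measure lborel (C \<inter> H2 m)"
    unfolding H1_def H2_def by (rule measure_hyperplane_split[OF C i])
  ultimately show "measure lborel (\<Union>A) powr u * measure lborel (\<Union>B) powr v \<le> measure lborel C"
    by (simp add: \<alpha>_def \<beta>_def algebra_simps)
qed

text \<open>Induction on the total number of boxes. The cutting step asks for two boxes in its first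
  family, so roles and weights are exchanged when the second family supplies them.\<close>

lemma brunn_minkowski_open_boxes:
  fixes A B :: "'a::euclidean_space set set"
  assumes "0 < u" "0 < v" "u + v = 1" "open_boxes A" "open_boxes B" "A \<noteq> {}" "B \<noteq> {}"
  shows "brunn_minkowski u v (\<Union>A) (\<Union>B)"
  using assms
proof (induction "card A + card B" arbitrary: A B u v rule: less_induct)
  case less
  have fin: "finite A" "finite B"
    using less.prems by (simp_all add: open_boxes_def)
  then have "card A \<noteq> 0" "card B \<noteq> 0"
    using less.prems by simp_all
  then consider "2 \<le> card A" | "2 \<le> card B" | "card A = 1" "card B = 1"
    by linarith
  then show ?case
  proof cases
    case 1
    show ?thesis
    proof (rule brunn_minkowski_open_boxes_step)
      fix A' B' :: "'a set set"
      assume "open_boxes A'" "open_boxes B'" "A' \<noteq> {}" "B' \<noteq> {}"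
        "card A' + card B' < card A + card B"
      then show "brunn_minkowski u v (\<Union>A') (\<Union>B')"
        by (intro less.hyps less.prems)
    qed (fact 1 less.prems)+
  next
    case 2
    have "brunn_minkowski v u (\<Union>B) (\<Union>A)"
    proof (rule brunn_minkowski_open_boxes_step)
      fix B' A' :: "'a set set"
      assume *: "open_boxes B'" "open_boxes A'" "B' \<noteq> {}" "A' \<noteq> {}"
        "card B' + card A' < card B + card A"
      have "card A' + card B' < card A + card B"
        using *(5) by (simp only: add.commute)
      then have "brunn_minkowski u v (\<Union>A') (\<Union>B')"
        by (rule less.hyps) (fact * less.prems)+
      then show "brunn_minkowski v u (\<Union>B') (\<Union>A')"
        by (rule brunn_minkowski_commute[THEN iffD1])
    next
      show "v + u = 1"
        using less.prems(3) by linarith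
    qed (fact 2 less.prems)+
    then show ?thesis
      unfolding brunn_minkowski_commute[of v u] .
  next
    case 3
    then obtain P Q where PQ: "A = {P}" "B = {Q}"
      by (auto simp: card_1_singleton_iff)
    then have "P \<noteq> {}" "Q \<noteq> {}" "\<exists>a b. P = box a b" "\<exists>a b. Q = box a b"
      using less.prems(4,5) by (simp_all add: open_boxes_def)
    then obtain a b c d where "P = box a b" "Q = box c d"
      by blast
    then show ?thesis
      using PQ \<open>P \<noteq> {}\<close> \<open>Q \<noteq> {}\<close>
      by (simp add: brunn_minkowski_box[OF less.prems(1-3)])
  qed
qed

section \<open>Passage to open sets and to compact convex sets\<close>

lemma measure_interior_compact_convex:
  fixes S :: "'a::euclidean_space set"
  assumes "compact S" "convex S"
  shows "measure lborel (interior S) = measure lborel S"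
  using measure_interior[of S] negligible_convex_frontier[of S] assms
  by (simp add: compact_imp_bounded compact_imp_closed)

text \<open>Finitely many of the closed boxes that exhaust \<open>U\<close> carry all but
  \<open>e\<close> of its volume. A division turns their overlapping union into nonoverlapping
  boxes, and passing to the nonempty interiors loses only null sets.\<close>

lemma open_boxes_approx:
  fixes U :: "'a::euclidean_space set"
  assumes U: "open U" "U \<in> fmeasurable lborel" and e: "0 < e"
  obtains D where "open_boxes D" "\<Union>D \<subseteq> U" "measure lborel U - e < measure lborel (\<Union>D)"
proof -
  obtain F where F: "countable F" "F \<subseteq> Pow U" "\<And>X. X \<in> F \<Longrightarrow> \<exists>a b. X = cbox a b" "\<Union>F = U"
    using open_countable_Union_open_cbox[OF U(1)] by metis
  have Fborel: "X \<in> sets borel" if "X \<in> F" for X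
    using F(3)[OF that] by auto
  have "measure lebesgue (\<Union>G) \<le> measure lborel U" if "G \<subseteq> F" "finite G" for G
  proof -
    have "\<Union>G \<in> sets borel"
      using that Fborel by (intro borel_closed closed_Union) (auto dest!: F(3) subsetD)
    moreover have "\<Union>G \<subseteq> U"
      using that F by blast
    ultimately show ?thesis
      using U by (simp add: measure_mono_fmeasurable)
  qed
  moreover have "X \<in> lmeasurable" if "X \<in> F" for X
    using F(3)[OF that] by auto
  ultimately obtain G where G: "G \<subseteq> F" "finite G"
    "measure lebesgue (\<Union>F) - e < measure lebesgue (\<Union>G)"
    using measure_countable_Union_approachable[OF F(1) e] by metis
  obtain p where p: "p division_of \<Union>G"
    using elementary_unions_intervals[OF G(2)] F(3) G(1) by (metis subsetD)
  note pD = division_ofD[OF p]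
  define q where "q = {k \<in> p. interior k \<noteq> {}}"
  have box: "\<exists>a b. interior k = box a b" if "k \<in> p" for k
    using pD(4)[OF that] interior_cbox by metis
  have disj: "interior k \<inter> interior l = {}" if "k \<in> p" "l \<in> p" "k \<noteq> l" for k l
    using that pD(5) by blast
  have "disjoint (interior ` q)"
    unfolding disjoint_def q_def using disj by blast
  moreover have "finite (interior ` q)"
    using pD(1) by (simp add: q_def)
  moreover have "\<forall>Q\<in>interior ` q. Q \<noteq> {} \<and> (\<exists>a b. Q = box a b)"
    using box by (auto simp only: q_def)
  ultimately have "open_boxes (interior ` q)"
    unfolding open_boxes_def by blast
  moreover have "\<Union>(interior ` q) \<subseteq> U"
  proof -
    have "\<Union>(interior ` q) \<subseteq> \<Union>p"
      unfolding q_def using interior_subset by blast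
    also have "\<dots> = \<Union>G"
      by (rule pD(6))
    also have "\<dots> \<subseteq> U"
      using G(1) F(2) by blast
    finally show ?thesis .
  qed
  moreover have "measure lborel (\<Union>G) \<le> measure lborel (\<Union>(interior ` q))"
  proof -
    have "measure lborel (\<Union>G) = measure lborel (\<Union>p)"
      using pD(6) by simp
    also have "\<dots> \<le> (\<Sum>k\<in>p. measure lborel k)"
      using pD(1) by (rule measure_Union_le) (use pD(4) in fastforce)
    also have "\<dots> = (\<Sum>k\<in>p. measure lborel (interior k))"
      using pD(4) by (intro sum.cong[OF refl] measure_interior_compact_convex[symmetric]) (metis compact_cbox convex_box(1))+
    also have "\<dots> = (\<Sum>k\<in>q. measure lborel (interior k))"
      using pD(1) by (intro sum.mono_neutral_right) (auto simp: q_def)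
    also have "\<dots> = measure lborel (\<Union>k\<in>q. interior k)"
    proof (rule measure_UNION'[symmetric])
      show "interior k \<in> fmeasurable lborel" if "k \<in> q" for k
        using box[of k] that unfolding q_def by auto
      show "pairwise (\<lambda>i j. disjnt (interior i) (interior j)) q"
        using disj by (auto simp: pairwise_def disjnt_def q_def)
    qed (use pD(1) in \<open>simp add: q_def\<close>)
    finally show ?thesis .
  qed
  moreover have "measure lebesgue (\<Union>G) = measure lborel (\<Union>G)"
    using G Fborel by (intro measure_completion) (auto intro!: sets.finite_Union)
  moreover have "measure lebesgue (\<Union>F) = measure lborel U"
    using U F(4) by simp
  ultimately show ?thesis
    using G(3) by (intro that[of "interior ` q"]) auto
qed

text \<open>Inner approximation is enough, because \<open>C\<close> also contains the combinations
  of points of the smaller sets; the error \<open>e\<close> then tends to 0.\<close>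

lemma brunn_minkowski_open:
  fixes A B :: "'a::euclidean_space set"
  assumes u: "0 < u" "0 < v" "u + v = 1"
    and A: "open A" "A \<noteq> {}" "A \<in> fmeasurable lborel"
    and B: "open B" "B \<noteq> {}" "B \<in> fmeasurable lborel"
  shows "brunn_minkowski u v A B"
  unfolding brunn_minkowski_def
proof (intro ballI impI)
  fix C :: "'a set"
  assume C: "C \<in> fmeasurable lborel" and sub: "\<forall>x\<in>A. \<forall>y\<in>B. u *\<^sub>R x + v *\<^sub>R y \<in> C"
  define \<alpha> where "\<alpha> = measure lborel A"
  define \<beta> where "\<beta> = measure lborel B"
  have pos: "0 < \<alpha>" "0 < \<beta>"
    using A B by (auto simp: \<alpha>_def \<beta>_def intro!: measure_open_pos)
  have ev: "(\<alpha> - e) powr u * (\<beta> - e) powr v \<le> measure lborel C" if e: "0 < e" "e < min \<alpha> \<beta>" for e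
  proof -
    obtain D where D: "open_boxes D" "\<Union>D \<subseteq> A" "\<alpha> - e < measure lborel (\<Union>D)"
      using open_boxes_approx[OF A(1,3) e(1)] unfolding \<alpha>_def by metis
    obtain E where E: "open_boxes E" "\<Union>E \<subseteq> B" "\<beta> - e < measure lborel (\<Union>E)"
      using open_boxes_approx[OF B(1,3) e(1)] unfolding \<beta>_def by metis
    have "D \<noteq> {}" "E \<noteq> {}"
      using D(3) E(3) e(2) by auto
    then have "brunn_minkowski u v (\<Union>D) (\<Union>E)"
      using u D(1) E(1) by (intro brunn_minkowski_open_boxes)
    moreover have "\<forall>x\<in>\<Union>D. \<forall>y\<in>\<Union>E. u *\<^sub>R x + v *\<^sub>R y \<in> C"
      using sub D(2) E(2) by blast
    ultimately have "measure lborel (\<Union>D) powr u * measure lborel (\<Union>E) powr v \<le> measure lborel C"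
      using C unfolding brunn_minkowski_def by blast
    moreover have "(\<alpha> - e) powr u \<le> measure lborel (\<Union>D) powr u"
      "(\<beta> - e) powr v \<le> measure lborel (\<Union>E) powr v"
      using D(3) E(3) e(2) u by (auto intro!: powr_mono2)
    then have "(\<alpha> - e) powr u * (\<beta> - e) powr v
        \<le> measure lborel (\<Union>D) powr u * measure lborel (\<Union>E) powr v"
      by (intro mult_mono) auto
    ultimately show ?thesis
      by linarith
  qed
  have "\<forall>\<^sub>F e in at_right 0. (\<alpha> - e) powr u * (\<beta> - e) powr v \<le> measure lborel C"
    using eventually_at_right_real[of 0 "min \<alpha> \<beta>"] pos
    by (auto elim!: eventually_mono intro!: ev)
  moreover have "((\<lambda>e. (\<alpha> - e) powr u * (\<beta> - e) powr v) \<longlongrightarrow> (\<alpha> - 0) powr u * (\<beta> - 0) powr v) (at_right 0)"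
    using pos by (intro tendsto_intros) auto
  ultimately have "(\<alpha> - 0) powr u * (\<beta> - 0) powr v \<le> measure lborel C"
    by (intro tendsto_upperbound[of _ _ "at_right 0"]) auto
  then show "measure lborel A powr u * measure lborel B powr v \<le> measure lborel C"
    by (simp add: \<alpha>_def \<beta>_def)
qed

text \<open>The frontier of a convex set is null, so the interiors have the full volumes; if one of
  the volumes is 0, the left-hand side vanishes.\<close>

lemma brunn_minkowski_compact_convex:
  fixes A B :: "'a::euclidean_space set"
  assumes u: "0 < u" "0 < v" "u + v = 1"
    and A: "compact A" "convex A" and B: "compact B" "convex B"
  shows "brunn_minkowski u v A B"
proof (cases "measure lborel A = 0 \<or> measure lborel B = 0")
  case True
  then show ?thesis
    by (elim disjE) (simp_all add: brunn_minkowski_def)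
next
  case False
  note int = measure_interior_compact_convex
  have "interior A \<noteq> {}" "interior B \<noteq> {}"
    using False int[OF A] int[OF B] by auto
  then have "brunn_minkowski u v (interior A) (interior B)"
    using u A B
    by (intro brunn_minkowski_open fmeasurable_lborelI)
       (auto intro: bounded_subset[OF _ interior_subset] compact_imp_bounded)
  then show ?thesis
    unfolding brunn_minkowski_def int[OF A] int[OF B] using interior_subset[of A] interior_subset[of B]
    by (meson subsetD)
qed

section \<open>Sections of a convex body with centered projection\<close>

lemma fiber_convex:
  assumes "convex D"
  shows "convex {x. (x, z) \<in> D}"
proof (rule convexI)
  fix x y u v
  assume "x \<in> {x. (x, z) \<in> D}" "y \<in> {x. (x, z) \<in> D}" and u: "0 \<le> u" "0 \<le> v" "u + v = (1::real)"
  then have "u *\<^sub>R (x, z) + v *\<^sub>R (y, z) \<in> D"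
    using convexD[OF assms, of "(x, z)" "(y, z)" u v] by simp
  then show "u *\<^sub>R x + v *\<^sub>R y \<in> {x. (x, z) \<in> D}"
    using u by (simp add: scaleR_add_left[symmetric])
qed

lemma fiber_compact:
  fixes D :: "('a::euclidean_space \<times> 'b::euclidean_space) set"
  assumes "compact D"
  shows "compact {x. (x, z) \<in> D}"
proof -
  have "{x. (x, z) \<in> D} = fst ` (D \<inter> UNIV \<times> {z})"
    by force
  then show ?thesis
    using assms by (auto intro!: compact_continuous_image compact_Int_closed closed_Times continuous_intros)
qed

lemma measure_fiber_log_concave:
  fixes D :: "('a::euclidean_space \<times> 'b::euclidean_space) set"
  assumes D: "compact D" "convex D" and u: "0 < u" "0 < v" "u + v = 1"
  shows "measure lborel {x. (x, z) \<in> D} powr u * measure lborel {x. (x, w) \<in> D} powr v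
    \<le> measure lborel {x. (x, u *\<^sub>R z + v *\<^sub>R w) \<in> D}"
proof -
  have "brunn_minkowski u v {x. (x, z) \<in> D} {x. (x, w) \<in> D}"
    by (intro brunn_minkowski_compact_convex u fiber_compact fiber_convex D)
  moreover have "{x. (x, u *\<^sub>R z + v *\<^sub>R w) \<in> D} \<in> fmeasurable lborel"
    using fiber_compact[OF D(1)] by (intro fmeasurable_lborelI) (auto intro: borel_compact compact_imp_bounded)
  moreover have "\<forall>x\<in>{x. (x, z) \<in> D}. \<forall>y\<in>{x. (x, w) \<in> D}.
      u *\<^sub>R x + v *\<^sub>R y \<in> {x. (x, u *\<^sub>R z + v *\<^sub>R w) \<in> D}"
    using convexD[OF D(2)] u by fastforce
  ultimately show ?thesis
    unfolding brunn_minkowski_def by blast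
qed

text \<open>
  Separating the hypograph of \<open>ln f\<close> from the point over 0 gives \<open>f z \<le> f 0 * exp (c \<bullet> z)\<close>; then
  \<open>1 - t \<le> exp (- t)\<close>.
\<close>

lemma log_concave_supergradient:
  fixes f :: "'b::euclidean_space \<Rightarrow> real"
  assumes nonneg: "\<And>z. 0 \<le> f z"
    and conc: "\<And>u v z w. \<lbrakk>0 < u; 0 < v; u + v = 1\<rbrakk> \<Longrightarrow> f z powr u * f w powr v \<le> f (u *\<^sub>R z + v *\<^sub>R w)"
    and e: "0 < e" "\<And>z. z \<in> ball 0 e \<Longrightarrow> 0 < f z"
  obtains c where "\<And>z. f z * (1 - c \<bullet> z) \<le> f 0"
proof -
  \<comment> \<open>The hypograph is strict, so that it misses the point to be separated, and it is
    restricted to the set where \<open>f\<close> is positive and \<open>ln\<close> is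
    meaningful.\<close>
  define H where "H = {(z, t). 0 < f z \<and> t < ln (f z)}"
  have f0: "0 < f 0"
    using e by simp
  have "convex H"
    unfolding convex_alt
  proof (intro ballI allI impI, clarify)
    fix z w :: 'b and s t a :: real
    assume H: "(z, s) \<in> H" "(w, t) \<in> H" and a: "0 \<le> a" "a \<le> 1"
    show "(1 - a) *\<^sub>R (z, s) + a *\<^sub>R (w, t) \<in> H"
    proof (cases "a = 0 \<or> a = 1")
      case True
      then show ?thesis
        using H by auto
    next
      case False
      then have a: "0 < a" "0 < 1 - a" "1 - a + a = 1"
        using a by auto
      have fz: "0 < f z" "s < ln (f z)" and fw: "0 < f w" "t < ln (f w)"
        using H by (auto simp: H_def)
      have le: "f z powr (1 - a) * f w powr a \<le> f ((1 - a) *\<^sub>R z + a *\<^sub>R w)"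
        using conc[OF a(2,1,3)] .
      have pos: "0 < f z powr (1 - a) * f w powr a"
        using fz fw by simp
      have "(1 - a) * s + a * t < (1 - a) * ln (f z) + a * ln (f w)"
        using fz fw a by (intro add_strict_mono mult_strict_left_mono)
      also have "\<dots> = ln (f z powr (1 - a) * f w powr a)"
        using fz fw by (simp add: ln_mult ln_powr)
      also have "\<dots> \<le> ln (f ((1 - a) *\<^sub>R z + a *\<^sub>R w))"
        using le pos by simp
      finally show ?thesis
        using le pos by (simp add: H_def)
    qed
  qed
  moreover have "(0, ln (f 0) - 1) \<in> H"
    using f0 by (simp add: H_def)
  then have "H \<noteq> {}"
    by blast
  moreover have "H \<inter> {(0, ln (f 0))} = {}"
    by (simp add: H_def)
  ultimately obtain q b where "q \<noteq> 0" "\<forall>x\<in>H. q \<bullet> x \<le> b" "\<forall>x\<in>{(0, ln (f 0))}. q \<bullet> x \<ge> b"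
    using separating_hyperplane_sets[of H "{(0, ln (f 0))}"] by auto
  then obtain v m where q: "(v, m) \<noteq> (0 :: 'b \<times> real)"
    and sep: "\<And>z t. (z, t) \<in> H \<Longrightarrow> v \<bullet> z + m * t \<le> m * ln (f 0)"
    by (cases q) (force simp: inner_Pair)
  have H0: "(0, ln (f 0) - 1) \<in> H"
    using f0 by (simp add: H_def)
  have "0 \<le> m"
    using sep[OF H0] by (simp add: algebra_simps)
  \<comment> \<open>A vertical hyperplane would confine the set where \<open>f\<close> is positive
    to a half-space with 0 on its boundary; the step of length \<open>e / 2\<close> along
    \<open>v\<close> contradicts this.\<close>
  moreover have "m \<noteq> 0"
  proof
    assume m: "m = 0"
    then have "v \<noteq> 0"
      using q by (simp add: zero_prod_def)
    define z where "z = (e / (2 * norm v)) *\<^sub>R v"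
    have "z \<in> ball 0 e"
      using e \<open>v \<noteq> 0\<close> by (simp add: z_def)
    then have "(z, ln (f z) - 1) \<in> H"
      using e by (simp add: H_def)
    from sep[OF this] have "v \<bullet> z \<le> 0"
      using m by simp
    moreover have "v \<bullet> z > 0"
      using e \<open>v \<noteq> 0\<close> by (simp add: z_def)
    ultimately show False
      by linarith
  qed
  ultimately have m: "0 < m"
    by linarith
  have bound: "ln (f z) + (v \<bullet> z) / m \<le> ln (f 0)" if "0 < f z" for z
  proof (rule field_le_epsilon)
    fix r :: real assume "0 < r"
    then have "(z, ln (f z) - r) \<in> H"
      using that by (simp add: H_def)
    from sep[OF this] show "ln (f z) + (v \<bullet> z) / m \<le> ln (f 0) + r"
      using m by (simp add: field_simps)
  qed
  \<comment> \<open>The witness for \<open>c\<close> is \<open>(- 1 / m) *\<^sub>R v\<close>, the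
    slope of the separating hyperplane.\<close>
  have "f z * (1 - ((- 1 / m) *\<^sub>R v) \<bullet> z) \<le> f 0" for z
  proof (cases "f z = 0")
    case True
    then show ?thesis
      using f0 by simp
  next
    case False
    then have fz: "0 < f z"
      using nonneg[of z] by linarith
    have "f z * (1 + (v \<bullet> z) / m) \<le> f z * exp ((v \<bullet> z) / m)"
      using fz by (intro mult_left_mono exp_ge_add_one_self) auto
    also have "\<dots> = exp (ln (f z) + (v \<bullet> z) / m)"
      using fz by (simp add: exp_add)
    also have "\<dots> \<le> f 0"
      using bound[OF fz] f0 by (metis exp_le_cancel_iff exp_ln)
    finally show ?thesis
      by simp
  qed
  then show ?thesis
    using that by blast
qed

text \<open>Subtracting the vanishing moment replaces the weight 1 by
  \<open>1 - c \<bullet> z\<close>; integrating over each fiber first then makes the supergradient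
  bound applicable. The projection is taken onto a coordinate factor so that Fubini applies
  directly.\<close>

lemma spingarn_inequality:
  fixes D :: "('a::euclidean_space \<times> 'b::euclidean_space) set"
  assumes D: "compact D" "convex D" "0 \<in> interior D"
    and bary: "\<And>c. (LINT w:D|lborel. c \<bullet> snd w) = 0"
  shows "measure lborel D \<le> measure lborel {x. (x, 0) \<in> D} * measure lborel (snd ` D)"
proof -
  define f where "f z = measure lborel {x. (x, z) \<in> D}" for z
  define C where "C = snd ` D"
  have C: "compact C"
    unfolding C_def using D(1) by (intro compact_continuous_image continuous_intros)
  have [measurable]: "D \<in> sets borel" "C \<in> sets borel"
    using D(1) C by (auto intro: borel_compact)
  obtain r where r: "0 < r" "ball (0 :: 'a \<times> 'b) r \<subseteq> D"
    using D(3) by (meson interior_subset mem_interior)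
  \<comment> \<open>By \<open>norm (x, z) \<le> norm x + norm z\<close>, the product of two balls of
    radius \<open>r / 2\<close> lies in the ball of radius \<open>r\<close>. Positivity near 0 is
    what rules out a vertical hyperplane.\<close>
  have fpos: "0 < f z" if z: "z \<in> ball 0 (r / 2)" for z
  proof -
    have "ball (0 :: 'a) (r / 2) \<subseteq> {x. (x, z) \<in> D}"
    proof clarify
      fix x :: 'a assume "x \<in> ball 0 (r / 2)"
      then have "norm (x, z) < r"
        using z norm_Pair_le[of x z] by simp
      then show "(x, z) \<in> D"
        using r by auto
    qed
    moreover have "{x. (x, z) \<in> D} \<in> fmeasurable lborel"
      using fiber_compact[OF D(1)] by (intro fmeasurable_lborelI) (auto intro: borel_compact compact_imp_bounded)
    ultimately have "measure lborel (ball (0 :: 'a) (r / 2)) \<le> f z"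
      unfolding f_def by (intro measure_mono_fmeasurable) auto
    then show ?thesis
      using content_ball_pos[of "r / 2" "0 :: 'a"] r by linarith
  qed
  obtain c where c: "\<And>z. f z * (1 - c \<bullet> z) \<le> f 0"
  proof (rule log_concave_supergradient[of f "r / 2"])
    show "f z powr u * f w powr v \<le> f (u *\<^sub>R z + v *\<^sub>R w)" if "0 < u" "0 < v" "u + v = 1" for u v z w
      unfolding f_def using D(1,2) that by (rule measure_fiber_log_concave)
  qed (use r fpos in \<open>auto simp: f_def\<close>)
  have int1: "set_integrable lborel D (\<lambda>w. c \<bullet> snd w)" and int2: "set_integrable lborel D (\<lambda>w. 1 :: real)"
    unfolding set_integrable_def
    by (intro borel_integrable_compact D continuous_intros)+
  define g where "g x z = indicator D (x, z) * (1 - c \<bullet> z)" for x z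
  have g: "case_prod g = (\<lambda>w. indicator D w *\<^sub>R (1 - c \<bullet> snd w))"
    by (auto simp: g_def fun_eq_iff)
  have intg: "integrable (lborel \<Otimes>\<^sub>M lborel) (case_prod g)"
    using set_integral_diff(1)[OF int2 int1] unfolding g set_integrable_def lborel_prod .
  have "measure lborel D = (LINT w:D|lborel. 1) - (LINT w:D|lborel. c \<bullet> snd w)"
    using bary[of c] emeasure_compact_finite[OF D(1)] by (simp add: set_lebesgue_integral_def)
  also have "\<dots> = (LINT w:D|lborel. 1 - c \<bullet> snd w)"
    by (rule set_integral_diff(2)[OF int2 int1, symmetric])
  also have "\<dots> = integral\<^sup>L (lborel \<Otimes>\<^sub>M lborel) (case_prod g)"
    unfolding g set_lebesgue_integral_def lborel_prod ..
  also have "\<dots> = (LINT z|lborel. LINT x|lborel. g x z)"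
    by (rule lborel_pair.integral_snd[OF intg, symmetric])
  also have "\<dots> \<le> (LINT z|lborel. f 0 * indicator C z)"
  proof (rule integral_mono)
    show "integrable lborel (\<lambda>z. LINT x|lborel. g x z)"
      by (rule lborel_pair.integrable_snd[OF intg])
    show "integrable lborel (\<lambda>z. f 0 * indicator C z)"
      using emeasure_compact_finite[OF C] by (intro integrable_mult_right integrable_real_indicator) auto
    show "(LINT x|lborel. g x z) \<le> f 0 * indicator C z" for z
    proof (cases "z \<in> C")
      case True
      define F where "F = {x. (x, z) \<in> D}"
      have "F \<in> sets borel"
        using fiber_compact[OF D(1)] by (simp add: F_def borel_compact)
      then have "(LINT x|lborel. indicator F x * (1 - c \<bullet> z)) = measure lborel F * (1 - c \<bullet> z)"
        by simp
      also have "(\<lambda>x. indicator F x * (1 - c \<bullet> z)) = (\<lambda>x. g x z)"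
        by (auto simp: g_def F_def indicator_def)
      finally have "(LINT x|lborel. g x z) = f z * (1 - c \<bullet> z)"
        by (simp add: f_def F_def)
      then show ?thesis
        using c[of z] True by simp
    next
      case False
      then have "(x, z) \<notin> D" for x
        using image_eqI[of z snd "(x, z)" D] by (auto simp: C_def)
      then have "g x z = 0" for x
        by (simp add: g_def)
      then show ?thesis
        using False by simp
    qed
  qed
  also have "\<dots> = f 0 * measure lborel C"
    by simp
  finally show ?thesis
    by (simp add: f_def C_def)
qed

section \<open>From the projection to the addition map\<close>

text \<open>For a fixed first component the shear translates the second one, so Fubini reduces the
  claim to translation invariance.\<close>

lemma lborel_distr_shear:
  "distr lborel lborel (\<lambda>w. (fst w, fst w + snd w)) = (lborel :: ('a::euclidean_space \<times> 'a) measure)"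
proof (rule measure_eqI)
  fix X :: "('a \<times> 'a) set"
  assume "X \<in> sets (distr lborel lborel (\<lambda>w. (fst w, fst w + snd w)))"
  then have [measurable]: "X \<in> sets borel"
    by simp
  have X: "X \<in> sets (lborel \<Otimes>\<^sub>M lborel)"
    unfolding lborel_prod by simp
  have [measurable]: "(\<lambda>w. (fst w, fst w + snd w)) \<in> borel \<rightarrow>\<^sub>M (borel :: ('a \<times> 'a) measure)"
    by (intro borel_measurable_continuous_onI continuous_intros)
  define Y where "Y = (\<lambda>w. (fst w, fst w + snd w)) -` X"
  have Yb: "Y \<in> sets borel"
    using measurable_sets_borel[of "\<lambda>w. (fst w, fst w + snd w)" borel X] by (simp add: Y_def)
  then have Y: "Y \<in> sets (lborel \<Otimes>\<^sub>M lborel)"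
    unfolding lborel_prod by simp
  have "emeasure (distr lborel lborel (\<lambda>w. (fst w, fst w + snd w))) X = emeasure lborel Y"
    by (simp add: emeasure_distr Y_def)
  also have "\<dots> = (\<integral>\<^sup>+x. emeasure lborel (Pair x -` Y) \<partial>lborel)"
    using lborel.emeasure_pair_measure_alt[OF Y] by (simp add: lborel_prod)
  also have "\<dots> = (\<integral>\<^sup>+x. emeasure lborel (Pair x -` X) \<partial>lborel)"
  proof (rule nn_integral_cong)
    fix x :: 'a
    have Xx: "Pair x -` X \<in> sets borel"
      using sets_Pair1[OF X] by simp
    have "emeasure lborel (Pair x -` Y) = emeasure lborel ((+) x -` (Pair x -` X))"
      by (simp add: Y_def vimage_def)
    also have "\<dots> = emeasure (distr lborel borel ((+) x)) (Pair x -` X)"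
      using Xx by (subst emeasure_distr) auto
    also have "\<dots> = emeasure lborel (Pair x -` X)"
      by (simp only: lborel_distr_plus)
    finally show "emeasure lborel (Pair x -` Y) = emeasure lborel (Pair x -` X)" .
  qed
  also have "\<dots> = emeasure lborel X"
    using lborel.emeasure_pair_measure_alt[OF X] by (simp add: lborel_prod)
  finally show "emeasure (distr lborel lborel (\<lambda>w. (fst w, fst w + snd w))) X = emeasure lborel X" .
qed simp

lemma spingarn_inequality_sum:
  fixes D :: "('a::euclidean_space \<times> 'a) set"
  assumes D: "compact D" "convex D" "0 \<in> interior D"
    and bary: "\<And>c. (LINT w:D|lborel. c \<bullet> (fst w + snd w)) = 0"
  shows "measure lborel D
    \<le> measure lborel {x. (x, - x) \<in> D} * measure lborel ((\<lambda>w. fst w + snd w) ` D)"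
proof -
  define T where "T w = (fst w, fst w + snd w)" for w :: "'a \<times> 'a"
  have T: "linear T" "bij T"
  proof -
    show "linear T"
      by (auto simp: T_def linear_iff algebra_simps)
    show "bij T"
      by (rule bij_betw_byWitness[where f' = "\<lambda>w. (fst w, snd w - fst w)"]) (auto simp: T_def)
  qed
  have [measurable]: "T \<in> borel \<rightarrow>\<^sub>M borel"
    unfolding T_def by (intro borel_measurable_continuous_onI continuous_intros)
  have distr: "distr lborel lborel T = lborel"
    unfolding T_def by (rule lborel_distr_shear)
  have [measurable]: "D \<in> sets borel"
    using D(1) by (rule borel_compact)
  have cT: "compact (T ` D)"
    unfolding T_def using D(1) by (intro compact_continuous_image continuous_intros)
  then have [measurable]: "T ` D \<in> sets borel"
    by (rule borel_compact)
  have vim: "T -` (T ` D) = D"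
    using T(2) by (simp add: inj_vimage_image_eq bij_is_inj)
  have "measure lborel (T ` D) \<le> measure lborel {x. (x, 0) \<in> T ` D} * measure lborel (snd ` T ` D)"
  proof (rule spingarn_inequality[OF cT])
    show "convex (T ` D)"
      using T(1) D(2) by (rule convex_linear_image)
    show "0 \<in> interior (T ` D)"
      using D(3) linear_0[OF T(1)] unfolding interior_bijective_linear_image[OF T] by force
    fix c :: 'a
    have [measurable]: "(\<lambda>w :: 'a \<times> 'a. c \<bullet> snd w) \<in> borel_measurable borel"
      by (intro borel_measurable_continuous_onI continuous_intros)
    have "(LINT w:T ` D|lborel. c \<bullet> snd w) = (LINT w|distr lborel lborel T. indicator (T ` D) w *\<^sub>R (c \<bullet> snd w))"
      by (simp add: distr set_lebesgue_integral_def)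
    also have "\<dots> = (LINT w|lborel. indicator (T ` D) (T w) *\<^sub>R (c \<bullet> snd (T w)))"
      by (rule integral_distr) measurable
    also have "\<dots> = (LINT w:D|lborel. c \<bullet> (fst w + snd w))"
      unfolding set_lebesgue_integral_def using vim
      by (intro Bochner_Integration.integral_cong) (auto simp: T_def indicator_def)
    finally show "(LINT w:T ` D|lborel. c \<bullet> snd w) = 0"
      using bary by simp
  qed
  moreover have "measure lborel (T ` D) = measure lborel D"
  proof -
    have "measure lborel (T ` D) = measure (distr lborel lborel T) (T ` D)"
      by (simp add: distr)
    also have "\<dots> = measure lborel D"
      by (subst measure_distr) (auto simp: vim)
    finally show ?thesis .
  qed
  moreover have "{x. (x, 0) \<in> T ` D} = {x. (x, - x) \<in> D}"
    by (force simp: T_def image_iff add_eq_0_iff)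
  moreover have "snd ` T ` D = (\<lambda>w. fst w + snd w) ` D"
    by (simp add: T_def image_image)
  ultimately show ?thesis
    by simp
qed

section \<open>Gauges and support functions\<close>

text \<open>A norm without symmetry: these are the Minkowski functionals of the convex bodies with 0
  in the interior, and equally the support functions of such bodies. Homogeneity includes
  \<open>t = 0\<close>, which forces \<open>g 0 = 0\<close>.\<close>

definition positive_gauge :: "('a::euclidean_space \<Rightarrow> real) \<Rightarrow> bool" where
  "positive_gauge g \<longleftrightarrow> (\<forall>x y. g (x + y) \<le> g x + g y) \<and> (\<forall>t\<ge>0. \<forall>x. g (t *\<^sub>R x) = t * g x)
     \<and> (\<forall>x. x \<noteq> 0 \<longrightarrow> 0 < g x)"

lemma positive_gaugeD:
  assumes "positive_gauge g"
  shows "g (x + y) \<le> g x + g y" "0 \<le> t \<Longrightarrow> g (t *\<^sub>R x) = t * g x" "x \<noteq> 0 \<Longrightarrow> 0 < g x"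
    "g 0 = 0" "0 \<le> g x"
proof -
  show "g (x + y) \<le> g x + g y" "0 \<le> t \<Longrightarrow> g (t *\<^sub>R x) = t * g x" and pos: "x \<noteq> 0 \<Longrightarrow> 0 < g x"
    using assms unfolding positive_gauge_def by blast+
  have "g (0 *\<^sub>R x) = 0 * g x"
    using assms unfolding positive_gauge_def by blast
  then show "g 0 = 0"
    by simp
  then show "0 \<le> g x"
    using pos by (cases "x = 0") auto
qed

lemma positive_gauge_convex_on:
  assumes "positive_gauge g"
  shows "convex_on UNIV g"
proof (rule convex_onI)
  fix t :: real and x y :: 'a
  assume "0 < t" "t < 1"
  then show "g ((1 - t) *\<^sub>R x + t *\<^sub>R y) \<le> (1 - t) * g x + t * g y"
    using positive_gaugeD(1)[OF assms, of "(1 - t) *\<^sub>R x" "t *\<^sub>R y"]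
    by (simp add: positive_gaugeD(2)[OF assms])
qed simp

lemma positive_gauge_sublevel_convex:
  assumes g: "positive_gauge g"
  shows "convex {x. g x \<le> c}" "convex {x. g x < c}"
proof -
  have comb: "g (u *\<^sub>R x + v *\<^sub>R y) \<le> max (g x) (g y)" if "0 \<le> u" "0 \<le> v" "u + v = 1" for u v x y
  proof -
    have "g (u *\<^sub>R x + v *\<^sub>R y) \<le> u * g x + v * g y"
      using positive_gaugeD(1)[OF g, of "u *\<^sub>R x" "v *\<^sub>R y"] that
      by (simp add: positive_gaugeD(2)[OF g])
    also have "\<dots> \<le> u * max (g x) (g y) + v * max (g x) (g y)"
      using that by (intro add_mono mult_left_mono) auto
    also have "\<dots> = max (g x) (g y)"
      using that by (simp flip: distrib_right)
    finally show ?thesis .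
  qed
  show "convex {x. g x \<le> c}"
    using comb by (intro convexI) (auto intro!: order_trans[OF comb])
  show "convex {x. g x < c}"
    using comb by (intro convexI) (auto intro!: le_less_trans[OF comb])
qed

lemma positive_gauge_continuous:
  assumes "positive_gauge g"
  shows "continuous_on S g"
  using convex_on_continuous[OF open_UNIV positive_gauge_convex_on[OF assms]]
    continuous_on_subset by blast

text \<open>By homogeneity the unit sphere decides; \<open>r\<close> and \<open>R\<close> are the
  extreme values of \<open>g\<close> there, attained by compactness.\<close>

lemma positive_gauge_bounds:
  fixes g :: "'a::euclidean_space \<Rightarrow> real"
  assumes g: "positive_gauge g"
  obtains r R where "0 < r" "0 < R" "\<And>x. r * norm x \<le> g x" "\<And>x. g x \<le> R * norm x"
proof -
  obtain i :: 'a where "i \<in> Basis"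
    using nonempty_Basis by blast
  then have "i \<in> sphere 0 1"
    by simp
  then have ne: "sphere 0 1 \<noteq> ({} :: 'a set)"
    by blast
  obtain a where a: "a \<in> sphere 0 1" "\<And>x. x \<in> sphere 0 1 \<Longrightarrow> g a \<le> g x"
    using continuous_attains_inf[OF compact_sphere ne positive_gauge_continuous[OF g]] by blast
  obtain b where b: "b \<in> sphere 0 1" "\<And>x. x \<in> sphere 0 1 \<Longrightarrow> g x \<le> g b"
    using continuous_attains_sup[OF compact_sphere ne positive_gauge_continuous[OF g]] by blast
  have "a \<noteq> 0" "b \<noteq> 0"
    using a b by auto
  then have "0 < g a" "0 < g b"
    using positive_gaugeD(3)[OF g] by auto
  moreover have "g a * norm x \<le> g x \<and> g x \<le> g b * norm x" for x
  proof (cases "x = 0")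
    case True
    then show ?thesis
      by (simp add: positive_gaugeD(4)[OF g])
  next
    case False
    then have s: "(1 / norm x) *\<^sub>R x \<in> sphere 0 1"
      by simp
    have eq: "g ((1 / norm x) *\<^sub>R x) = g x / norm x"
      by (simp add: positive_gaugeD(2)[OF g])
    show ?thesis
      using a(2)[OF s] b(2)[OF s] False unfolding eq by (simp add: field_simps)
  qed
  ultimately show ?thesis
    using that by blast
qed

lemma positive_gauge_le_1:
  fixes g :: "'a::euclidean_space \<Rightarrow> real"
  assumes g: "positive_gauge g"
  shows "compact {x. g x \<le> 1}" "convex {x. g x \<le> 1}" "0 \<in> interior {x. g x \<le> 1}"
proof -
  obtain r R where r: "0 < r" "0 < R" "\<And>x. r * norm x \<le> g x" "\<And>x. g x \<le> R * norm x"
    using positive_gauge_bounds[OF g] by metis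
  have "{x. g x \<le> 1} \<subseteq> cball 0 (1 / r)"
  proof clarify
    fix x assume "g x \<le> 1"
    then have "r * norm x \<le> 1"
      using r(3)[of x] by linarith
    then show "x \<in> cball 0 (1 / r)"
      using r(1) by (simp add: field_simps)
  qed
  moreover have "closed {x. g x \<le> 1}"
    by (intro closed_Collect_le positive_gauge_continuous[OF g] continuous_on_const)
  ultimately show "compact {x. g x \<le> 1}"
    using bounded_subset[OF bounded_cball] by (simp add: compact_eq_bounded_closed)
  show "convex {x. g x \<le> 1}"
    by (rule positive_gauge_sublevel_convex(1)[OF g])
  have "ball 0 (1 / R) \<subseteq> {x. g x \<le> 1}"
  proof clarify
    fix x :: 'a assume "x \<in> ball 0 (1 / R)"
    then have "R * norm x < 1"
      using r(2) by (simp add: field_simps)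
    then show "g x \<le> 1"
      using r(4)[of x] by linarith
  qed
  then show "0 \<in> interior {x. g x \<le> 1}"
    using r(2) by (auto simp: mem_interior intro!: exI[of _ "1 / R"])
qed

text \<open>Once \<open>x\<close> and \<open>y\<close> are scaled to level 1, their convex
  combination with weights proportional to \<open>g x\<close> and \<open>g y\<close> is the sum
  \<open>x + y\<close> divided by \<open>g x + g y\<close>.\<close>

lemma positive_gaugeI_convex:
  fixes g :: "'a::euclidean_space \<Rightarrow> real"
  assumes hom: "\<And>t x. 0 \<le> t \<Longrightarrow> g (t *\<^sub>R x) = t * g x" and pos: "\<And>x. x \<noteq> 0 \<Longrightarrow> 0 < g x"
    and conv: "convex {x. g x \<le> 1}"
  shows "positive_gauge g"
  unfolding positive_gauge_def
proof (intro conjI allI impI)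
  fix x y :: 'a
  have "g 0 = 0"
    using hom[of 0 0] by simp
  show "g (x + y) \<le> g x + g y"
  proof (cases "x = 0 \<or> y = 0")
    case True
    then show ?thesis
      using \<open>g 0 = 0\<close> by auto
  next
    case False
    define a where "a = g x"
    define b where "b = g y"
    have ab: "0 < a" "0 < b"
      using False pos by (auto simp: a_def b_def)
    have "(a / (a + b)) *\<^sub>R ((1 / a) *\<^sub>R x) + (b / (a + b)) *\<^sub>R ((1 / b) *\<^sub>R y) \<in> {x. g x \<le> 1}"
    proof (rule convexD[OF conv])
      show "(1 / a) *\<^sub>R x \<in> {x. g x \<le> 1}" "(1 / b) *\<^sub>R y \<in> {x. g x \<le> 1}"
        using ab hom[of "1 / a" x] hom[of "1 / b" y] by (simp_all add: a_def b_def)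
      show "a / (a + b) + b / (a + b) = 1"
        using ab by (simp flip: add_divide_distrib)
    qed (use ab in auto)
    also have "(a / (a + b)) *\<^sub>R ((1 / a) *\<^sub>R x) + (b / (a + b)) *\<^sub>R ((1 / b) *\<^sub>R y)
        = (1 / (a + b)) *\<^sub>R (x + y)"
      using ab by (simp add: scaleR_add_right)
    finally have "g (x + y) / (a + b) \<le> 1"
      using ab hom[of "1 / (a + b)" "x + y"] by simp
    then show ?thesis
      using ab by (simp add: field_simps a_def b_def)
  qed
qed (use hom pos in auto)

section \<open>Support functions and the bodies they determine\<close>

lemma support_function_bdd_above:
  assumes "compact K"
  shows "bdd_above ((\<lambda>y. x \<bullet> y) ` K)"
  using assms by (intro bounded_imp_bdd_above compact_imp_bounded compact_continuous_image continuous_intros)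

lemma support_function_upper:
  assumes "compact K" "y \<in> K"
  shows "x \<bullet> y \<le> support_function K x"
  unfolding support_function_def
  using assms by (intro cSUP_upper support_function_bdd_above)

lemma support_function_le_iff:
  assumes "compact K" "K \<noteq> {}"
  shows "support_function K x \<le> a \<longleftrightarrow> (\<forall>y\<in>K. x \<bullet> y \<le> a)"
  unfolding support_function_def
  using assms by (intro cSUP_le_iff support_function_bdd_above)

lemma convex_body_not_empty: "convex_body K \<Longrightarrow> K \<noteq> {}"
  unfolding convex_body_def by (metis interior_empty)

lemma polar_body_eq:
  assumes "convex_body K"
  shows "polar_body K = {x. support_function K x \<le> 1}"
  using assms support_function_le_iff[of K _ 1] convex_body_not_empty[OF assms]
  by (auto simp: polar_body_def convex_body_def)

lemma positive_gauge_support_function: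
  assumes K: "convex_body K" and 0: "0 \<in> interior K"
  shows "positive_gauge (support_function K)"
  unfolding positive_gauge_def
proof (intro conjI allI impI)
  have c: "compact K" and ne: "K \<noteq> {}"
    using K convex_body_not_empty by (auto simp: convex_body_def)
  note upper = support_function_upper[OF c] and le_iff = support_function_le_iff[OF c ne]
  show "support_function K (x + y) \<le> support_function K x + support_function K y" for x y
    unfolding le_iff by (auto simp: inner_add_left intro!: add_mono upper)
  have scale: "support_function K (t *\<^sub>R x) \<le> t * support_function K x" if "0 \<le> t" for t x
    unfolding le_iff using that by (auto intro!: mult_left_mono upper)
  show "support_function K (t *\<^sub>R x) = t * support_function K x" if "0 \<le> t" for t x
  proof (cases "t = 0")
    case True
    have "support_function K 0 = 0"
      using ne by (simp add: support_function_def)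
    with True show ?thesis
      by simp
  next
    case False
    then have "support_function K x \<le> (1 / t) * support_function K (t *\<^sub>R x)"
      using that scale[of "1 / t" "t *\<^sub>R x"] by simp
    then show ?thesis
      using scale[OF that, of x] that False by (simp add: field_simps)
  qed
  obtain e where e: "0 < e" "cball 0 e \<subseteq> K"
    using 0 by (meson mem_interior_cball)
  show "0 < support_function K x" if "x \<noteq> 0" for x
  proof -
    have "(e / norm x) *\<^sub>R x \<in> K"
      using e that by (intro subsetD[OF e(2)]) simp
    from upper[OF this, of x] have "e * norm x \<le> support_function K x"
      using that by (simp add: power2_norm_eq_inner[symmetric] power2_eq_square)
    then show ?thesis
      using e(1) that by (smt (verit) mult_pos_pos zero_less_norm_iff)
  qed
qed

text \<open>A point outside is strictly separated by some \<open>a\<close> and then violates the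
  bound in direction \<open>- a\<close>. This is the uniqueness half of the definite description in
  \<open>body_with_support\<close>.\<close>

lemma convex_body_eq_support:
  assumes M: "convex_body M"
  shows "M = {y. \<forall>x. x \<bullet> y \<le> support_function M x}"
proof
  have c: "compact M" "convex M" "M \<noteq> {}"
    using M convex_body_not_empty by (auto simp: convex_body_def)
  show "M \<subseteq> {y. \<forall>x. x \<bullet> y \<le> support_function M x}"
    using support_function_upper[OF c(1)] by blast
  show "{y. \<forall>x. x \<bullet> y \<le> support_function M x} \<subseteq> M"
  proof clarify
    fix y assume y: "\<forall>x. x \<bullet> y \<le> support_function M x"
    show "y \<in> M"
    proof (rule ccontr)
      assume "y \<notin> M"
      then obtain a b where ab: "a \<bullet> y < b" "\<forall>x\<in>M. b < a \<bullet> x"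
        using separating_hyperplane_closed_point[of M y] c compact_imp_closed by blast
      have "support_function M (- a) \<le> - b"
        unfolding support_function_le_iff[OF c(1,3)] using ab by (auto intro: less_imp_le)
      then show False
        using y[rule_format, of "- a"] ab(1) by simp
    qed
  qed
qed

text \<open>Separating \<open>z\<close> from the sublevel set \<open>h x < h z\<close> and rescaling
  gives a linear form dominated by \<open>h\<close> that touches it at \<open>z\<close>. This
  finite-dimensional Hahn-Banach statement shows below that the prescribed support function is
  attained.\<close>

lemma positive_gauge_supporting_vector:
  fixes h :: "'a::euclidean_space \<Rightarrow> real"
  assumes h: "positive_gauge h"
  obtains y where "\<And>x. x \<bullet> y \<le> h x" "h z \<le> z \<bullet> y"
proof (cases "z = 0")
  case True
  then show ?thesis
    using that[of 0] positive_gaugeD(4,5)[OF h] by simp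
next
  case False
  define c where "c = h z"
  have c: "0 < c"
    using positive_gaugeD(3)[OF h False] by (simp add: c_def)
  define S where "S = {x. h x < c}"
  have "convex S"
    unfolding S_def by (rule positive_gauge_sublevel_convex(2)[OF h])
  moreover have "0 \<in> S"
    using c positive_gaugeD(4)[OF h] by (simp add: S_def)
  moreover have "S \<inter> {z} = {}"
    by (simp add: S_def c_def)
  ultimately obtain a b where a: "a \<noteq> 0" and S: "\<forall>x\<in>S. a \<bullet> x \<le> b" and z: "b \<le> a \<bullet> z"
    using separating_hyperplane_sets[of S "{z}"] by auto
  \<comment> \<open>Scaled to level \<open>s * c < c\<close>, a point enters \<open>S\<close>;
    letting \<open>s\<close> tend to 1 afterwards gives the sharp bound.\<close>
  have inS: "(s * c / h x) *\<^sub>R x \<in> S" if "x \<noteq> 0" "0 \<le> s" "s < 1" for x s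
    using that c positive_gaugeD(3)[OF h that(1)]
    by (simp add: S_def positive_gaugeD(2)[OF h])
  have le: "c * (a \<bullet> x) \<le> b * h x" if "x \<noteq> 0" for x
  proof -
    have hx: "0 < h x"
      using positive_gaugeD(3)[OF h that] .
    have "s * (c * (a \<bullet> x)) \<le> b * h x" if "0 < s" "s < 1" for s
      using S[rule_format, OF inS[OF \<open>x \<noteq> 0\<close>, of s]] that hx by (simp add: field_simps)
    then show ?thesis
      by (rule field_le_mult_one_interval)
  qed
  have "0 < c * (a \<bullet> a)"
    using a c by simp
  also have "\<dots> \<le> b * h a"
    using le[OF a] .
  finally have b: "0 < b"
    using positive_gaugeD(5)[OF h, of a] by (simp add: zero_less_mult_iff)
  show ?thesis
  \<comment> \<open>The factor \<open>c / b\<close> raises the separating value \<open>b\<close> to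
    the level \<open>c = h z\<close>.\<close>
  proof (rule that[of "(c / b) *\<^sub>R a"])
    show "x \<bullet> (c / b) *\<^sub>R a \<le> h x" for x
      using le[of x] b positive_gaugeD(4)[OF h]
      by (cases "x = 0") (simp_all add: field_simps inner_commute)
    show "h z \<le> z \<bullet> (c / b) *\<^sub>R a"
      using z b c by (simp add: field_simps inner_commute c_def)
  qed
qed

text \<open>A definite description is informative only with existence and uniqueness. The candidate
  \<open>M\<close> is the intersection of the half-spaces prescribed by \<open>h\<close>; supporting
  vectors show that none of them is loose, and a body is determined by its support function.\<close>

lemma body_with_support_gauge:
  fixes h :: "real ^ 'n \<Rightarrow> real"
  assumes h: "positive_gauge h"
  shows "convex_body (body_with_support h)" "support_function (body_with_support h) x = h x"
proof -
  define M where "M = {y. \<forall>x. x \<bullet> y \<le> h x}"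
  obtain r R where r: "0 < r" "0 < R" "\<And>x. r * norm x \<le> h x" "\<And>x. h x \<le> R * norm x"
    using positive_gauge_bounds[OF h] by metis
  have "M = (\<Inter>x. {y. x \<bullet> y \<le> h x})"
    by (auto simp: M_def)
  then have "convex M" "closed M"
    by (auto intro!: convex_INT closed_INT convex_halfspace_le closed_halfspace_le)
  have "M \<subseteq> cball 0 R"
  proof
    fix y assume "y \<in> M"
    then have "norm y * norm y \<le> R * norm y"
      using r(4)[of y] by (auto simp: M_def power2_norm_eq_inner[symmetric] power2_eq_square dest: spec[of _ y])
    then show "y \<in> cball 0 R"
      using r(2) by (cases "y = 0") auto
  qed
  then have "compact M"
    using \<open>closed M\<close> bounded_subset[OF bounded_cball] by (auto simp: compact_eq_bounded_closed)
  have "ball 0 r \<subseteq> M"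
  proof
    fix y :: "real ^ 'n" assume y: "y \<in> ball 0 r"
    have "x \<bullet> y \<le> h x" for x
    proof -
      have "x \<bullet> y \<le> norm x * norm y"
        by (rule norm_cauchy_schwarz)
      also have "\<dots> \<le> norm x * r"
        using y by (intro mult_left_mono) auto
      also have "\<dots> \<le> h x"
        using r(3)[of x] by (simp add: mult.commute)
      finally show ?thesis .
    qed
    then show "y \<in> M"
      by (simp add: M_def)
  qed
  then have "0 \<in> interior M"
    using r(1) by (auto simp: mem_interior)
  then have M: "convex_body M"
    using \<open>convex M\<close> \<open>compact M\<close> by (auto simp: convex_body_def)
  have supp: "support_function M x = h x" for x
  proof (rule antisym)
    show "support_function M x \<le> h x"
      unfolding support_function_le_iff[OF \<open>compact M\<close> convex_body_not_empty[OF M]] by (simp add: M_def)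
    obtain y where y: "\<And>w. w \<bullet> y \<le> h w" "h x \<le> x \<bullet> y"
      using positive_gauge_supporting_vector[OF h, of x] by metis
    then have "y \<in> M"
      by (simp add: M_def)
    then show "h x \<le> support_function M x"
      using support_function_upper[OF \<open>compact M\<close>, of y x] y(2) by linarith
  qed
  have "body_with_support h = M"
    unfolding body_with_support_def
  proof (rule the_equality)
    fix M' assume M': "convex_body M' \<and> (\<forall>x. support_function M' x = h x)"
    then show "M' = M"
      using convex_body_eq_support[of M'] by (simp add: M_def)
  qed (use M supp in blast)
  then show "convex_body (body_with_support h)" "support_function (body_with_support h) x = h x"
    using M supp by auto
qed

text \<open>Through this the two constructed bodies enter the inequality only as unit balls of
  gauges.\<close>

lemma polar_body_with_support:
  fixes h :: "real ^ 'n \<Rightarrow> real"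
  assumes "positive_gauge h"
  shows "polar_body (body_with_support h) = {x. h x \<le> 1}"
  using polar_body_eq[OF body_with_support_gauge(1)[OF assms]] body_with_support_gauge(2)[OF assms] by simp

section \<open>l_p combinations and infimal convolutions of gauges\<close>

lemma powr_convex_combination:
  fixes a b :: real
  assumes q: "1 \<le> q" and a: "0 \<le> a" "0 \<le> b" and u: "0 \<le> u" "0 \<le> v" "u + v = 1"
  shows "(u * a + v * b) powr q \<le> u * a powr q + v * b powr q"
proof (cases "a = 0 \<or> b = 0")
  case True
  \<comment> \<open>With one argument zero the claim reduces to \<open>s powr q \<le> s\<close> on
    the unit interval.\<close>
  have "(s * c) powr q \<le> s * c powr q" if "0 \<le> s" "s \<le> 1" "0 \<le> c" for s c
  proof -
    have "s powr q \<le> s powr 1"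
      using that q by (intro powr_mono') auto
    then show ?thesis
      using that by (simp add: powr_mult mult_right_mono)
  qed
  then show ?thesis
    using True a u by auto
next
  case False
  then have "0 < a" "0 < b"
    using a by auto
  moreover have "u = 1 - v"
    using u by simp
  ultimately show ?thesis
    using convex_onD[OF powr_convex[OF q], of v a b] u(1,2) by auto
qed

lemma lp_combination_finite:
  assumes "1 \<le> q" "0 \<le> a" "0 \<le> b"
  shows "lp_combination (ereal q) a b powr q = a powr q + b powr q"
    "lp_combination (ereal q) a b \<le> 1 \<longleftrightarrow> a powr q + b powr q \<le> 1"
proof -
  show *: "lp_combination (ereal q) a b powr q = a powr q + b powr q"
    using assms by (simp add: lp_combination_def powr_powr)
  have "0 \<le> lp_combination (ereal q) a b"
    by (simp add: lp_combination_def)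
  then show "lp_combination (ereal q) a b \<le> 1 \<longleftrightarrow> a powr q + b powr q \<le> 1"
    using powr_le1[of q "lp_combination (ereal q) a b"] gr_one_powr[of "lp_combination (ereal q) a b" q] assms(1)
    unfolding *[symmetric] by linarith
qed

text \<open>Subadditivity is derived from convexity of the unit ball: at level 1 the outer root
  disappears and the powers of \<open>f\<close> and \<open>g\<close> are convex. For infinite
  \<open>p\<close> the ball is a product.\<close>

lemma positive_gauge_lp_combination:
  fixes f :: "'a::euclidean_space \<Rightarrow> real" and g :: "'b::euclidean_space \<Rightarrow> real"
  assumes f: "positive_gauge f" and g: "positive_gauge g" and p: "1 \<le> p"
  shows "positive_gauge (\<lambda>w. lp_combination p (f (fst w)) (g (snd w)))"
proof (rule positive_gaugeI_convex)
  note fD = positive_gaugeD[OF f] and gD = positive_gaugeD[OF g]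
  have p_cases: "(\<And>q. p = ereal q \<Longrightarrow> 1 \<le> q \<Longrightarrow> P) \<Longrightarrow> (p = \<infinity> \<Longrightarrow> P) \<Longrightarrow> P" for P
    using p by (cases p) auto
  show "lp_combination p (f (fst (t *\<^sub>R w))) (g (snd (t *\<^sub>R w)))
      = t * lp_combination p (f (fst w)) (g (snd w))" if t: "0 \<le> t" for t and w :: "'a \<times> 'b"
  proof (rule p_cases)
    fix q assume q: "p = ereal q" "1 \<le> q"
    have "((t * a) powr q + (t * b) powr q) powr (1 / q) = t * (a powr q + b powr q) powr (1 / q)"
      if "0 \<le> a" "0 \<le> b" for a b
    proof -
      have "(t * a) powr q + (t * b) powr q = t powr q * (a powr q + b powr q)"
        using t that by (simp add: powr_mult distrib_left)
      then show ?thesis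
        using t q by (simp add: powr_mult powr_powr)
    qed
    then show ?thesis
      using q t by (simp add: lp_combination_def fD gD)
  next
    assume "p = \<infinity>"
    then show ?thesis
      using t by (simp add: lp_combination_def fD gD max_mult_distrib_left)
  qed
  show "0 < lp_combination p (f (fst w)) (g (snd w))" if w: "w \<noteq> 0" for w :: "'a \<times> 'b"
  proof -
    have pos: "0 < f (fst w) \<or> 0 < g (snd w)"
      using w fD(3) gD(3) by (auto simp: prod_eq_iff)
    show ?thesis
    proof (rule p_cases)
      fix q assume q: "p = ereal q" "1 \<le> q"
      have "0 < f (fst w) powr q + g (snd w) powr q"
        using pos by (auto intro: add_pos_nonneg add_nonneg_pos)
      then show ?thesis
        using q by (simp add: lp_combination_def)
    next
      assume "p = \<infinity>"
      then show ?thesis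
        using pos by (auto simp: lp_combination_def)
    qed
  qed
  show "convex {w. lp_combination p (f (fst w)) (g (snd w)) \<le> 1}"
  proof (rule p_cases)
    fix q assume q: "p = ereal q" "1 \<le> q"
    show ?thesis
    proof (rule convexI, clarsimp simp only: mem_Collect_eq q(1) lp_combination_finite(2)[OF q(2) fD(5) gD(5)])
      fix x y :: 'a and x' y' :: 'b and u v :: real
      assume xy: "f (fst (x, x')) powr q + g (snd (x, x')) powr q \<le> 1"
        "f (fst (y, y')) powr q + g (snd (y, y')) powr q \<le> 1" and u: "0 \<le> u" "0 \<le> v" "u + v = 1"
      have 1: "f (u *\<^sub>R x + v *\<^sub>R y) powr q \<le> u * f x powr q + v * f y powr q"
      proof -
        have "f (u *\<^sub>R x + v *\<^sub>R y) \<le> u * f x + v * f y"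
          using fD(1)[of "u *\<^sub>R x" "v *\<^sub>R y"] u by (simp add: fD(2))
        then have "f (u *\<^sub>R x + v *\<^sub>R y) powr q \<le> (u * f x + v * f y) powr q"
          using q fD(5) by (intro powr_mono2) auto
        also have "\<dots> \<le> u * f x powr q + v * f y powr q"
          by (rule powr_convex_combination[OF q(2) fD(5) fD(5) u])
        finally show ?thesis .
      qed
      have 2: "g (u *\<^sub>R x' + v *\<^sub>R y') powr q \<le> u * g x' powr q + v * g y' powr q"
      proof -
        have "g (u *\<^sub>R x' + v *\<^sub>R y') \<le> u * g x' + v * g y'"
          using gD(1)[of "u *\<^sub>R x'" "v *\<^sub>R y'"] u by (simp add: gD(2))
        then have "g (u *\<^sub>R x' + v *\<^sub>R y') powr q \<le> (u * g x' + v * g y') powr q"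
          using q gD(5) by (intro powr_mono2) auto
        also have "\<dots> \<le> u * g x' powr q + v * g y' powr q"
          by (rule powr_convex_combination[OF q(2) gD(5) gD(5) u])
        finally show ?thesis .
      qed
      have "u * (f x powr q + g x' powr q) + v * (f y powr q + g y' powr q) \<le> u * 1 + v * 1"
        using xy u by (intro add_mono mult_left_mono) auto
      then show "f (fst (u *\<^sub>R (x, x') + v *\<^sub>R (y, y'))) powr q
          + g (snd (u *\<^sub>R (x, x') + v *\<^sub>R (y, y'))) powr q \<le> 1"
        using 1 2 u by (simp add: algebra_simps)
    qed
  next
    assume "p = \<infinity>"
    then have "{w. lp_combination p (f (fst w)) (g (snd w)) \<le> 1} = {x. f x \<le> 1} \<times> {y. g y \<le> 1}"
      by (auto simp: lp_combination_def)
    then show ?thesis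
      using positive_gauge_le_1(2)[OF f] positive_gauge_le_1(2)[OF g] by (simp add: convex_Times)
  qed
qed

lemma positive_gauge_antidiagonal:
  assumes "positive_gauge N"
  shows "positive_gauge (\<lambda>x. N (x, - x))"
  unfolding positive_gauge_def
proof (intro conjI allI impI)
  show "N (x + y, - (x + y)) \<le> N (x, - x) + N (y, - y)" for x y
    using positive_gaugeD(1)[OF assms, of "(x, - x)" "(y, - y)"] by simp
  show "N (t *\<^sub>R x, - (t *\<^sub>R x)) = t * N (x, - x)" if "0 \<le> t" for t x
    using positive_gaugeD(2)[OF assms that, of "(x, - x)"] by simp
  show "0 < N (x, - x)" if "x \<noteq> 0" for x
    using that by (intro positive_gaugeD(3)[OF assms]) (auto simp: prod_eq_iff)
qed

lemma inf_convolution_le: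
  assumes "positive_gauge N"
  shows "Inf {N (x1, x2) | x1 x2. x1 + x2 = z1 + z2} \<le> N (z1, z2)"
  using positive_gaugeD(5)[OF assms] by (intro cInf_lower) (auto intro!: bdd_belowI[of _ 0])

text \<open>The infimal convolution is the quotient gauge of \<open>N\<close> under addition.
  Positivity is the delicate point, as an infimum of positive numbers may vanish; it follows from
  \<open>r * norm w \<le> N w\<close> and \<open>norm z \<le> 2 * norm (x, y)\<close> for every
  decomposition of \<open>z\<close>.\<close>

lemma positive_gauge_inf_convolution:
  fixes N :: "'a::euclidean_space \<times> 'a \<Rightarrow> real"
  assumes N: "positive_gauge N"
  shows "positive_gauge (\<lambda>z. Inf {N (x1, x2) | x1 x2. x1 + x2 = z})"
proof -
  define h where "h z = Inf {N (x1, x2) | x1 x2. x1 + x2 = z}" for z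
  note ND = positive_gaugeD[OF N]
  have le: "h (x + y) \<le> N (x, y)" for x y
    unfolding h_def by (rule inf_convolution_le[OF N])
  have greatest: "c \<le> h z" if "\<And>x y. x + y = z \<Longrightarrow> c \<le> N (x, y)" for c z
  proof -
    have "{N (x1, x2) | x1 x2. x1 + x2 = z} \<noteq> {}"
      using add_0_left[of z] by blast
    then show ?thesis
      unfolding h_def using that by (intro cInf_greatest) auto
  qed
  have "positive_gauge h"
    unfolding positive_gauge_def
  proof (intro conjI allI impI)
    fix z w
    \<comment> \<open>The two infima are taken one after the other, so no near-minimizers have to be
      chosen.\<close>
    have "h (z + w) - N (x, y) \<le> h w" if xy: "x + y = z" for x y
    proof (rule greatest)
      fix x' y' assume "x' + y' = w"
      with xy have "z + w = (x + x') + (y + y')"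
        by (simp add: algebra_simps)
      then have "h (z + w) \<le> N (x + x', y + y')"
        using le[of "x + x'" "y + y'"] by simp
      also have "\<dots> \<le> N (x, y) + N (x', y')"
        using ND(1)[of "(x, y)" "(x', y')"] by simp
      finally show "h (z + w) - N (x, y) \<le> N (x', y')"
        by simp
    qed
    then have "h (z + w) - h w \<le> h z"
      by (intro greatest) (auto simp: algebra_simps)
    then show "h (z + w) \<le> h z + h w"
      by simp
  next
    have le_scale: "h (t *\<^sub>R z) \<le> t * h z" if t: "0 < t" for t z
    proof -
      have "h (t *\<^sub>R z) / t \<le> h z"
      proof (rule greatest)
        fix x y assume "x + y = z"
        then have "h (t *\<^sub>R z) \<le> N (t *\<^sub>R x, t *\<^sub>R y)"
          using le[of "t *\<^sub>R x" "t *\<^sub>R y"] by (simp flip: scaleR_add_right)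
        also have "\<dots> = t * N (x, y)"
          using ND(2)[of t "(x, y)"] t by simp
        finally show "h (t *\<^sub>R z) / t \<le> N (x, y)"
          using t by (simp add: field_simps)
      qed
      then show ?thesis
        using t by (simp add: field_simps)
    qed
    show "h (t *\<^sub>R z) = t * h z" if "0 \<le> t" for t z
    proof (cases "t = 0")
      case True
      have "h 0 = 0"
        using le[of 0 0] ND(4) ND(5) by (intro antisym greatest) (auto simp: zero_prod_def)
      with True show ?thesis
        by simp
    next
      case False
      then have "0 < t"
        using that by simp
      have "h z \<le> (1 / t) * h (t *\<^sub>R z)"
        using le_scale[of "1 / t" "t *\<^sub>R z"] \<open>0 < t\<close> by simp
      then show ?thesis
        using le_scale[OF \<open>0 < t\<close>, of z] \<open>0 < t\<close> by (simp add: field_simps)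
    qed
  next
    fix z :: 'a assume "z \<noteq> 0"
    obtain r where r: "0 < r" "\<And>w. r * norm w \<le> N w"
      using positive_gauge_bounds[OF N] by metis
    have "r / 2 * norm z \<le> h z"
    proof (rule greatest)
      fix x y assume "x + y = z"
      then have "norm z \<le> norm x + norm y"
        using norm_triangle_ineq by blast
      also have "\<dots> \<le> 2 * norm (x, y)"
        using norm_fst_le[of x y] norm_snd_le[of y x] by simp
      finally have "r / 2 * norm z \<le> r * norm (x, y)"
        using r(1) by simp
      then show "r / 2 * norm z \<le> N (x, y)"
        using r(2)[of "(x, y)"] by linarith
    qed
    moreover have "0 < r / 2 * norm z"
      using r(1) \<open>z \<noteq> 0\<close> by simp
    ultimately show "0 < h z"
      by linarith
  qed
  then show ?thesis
    unfolding h_def .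
qed

section \<open>Moments of unit balls of gauges\<close>

lemma nn_integral_lborel_scale:
  fixes \<phi> :: "'a::euclidean_space \<Rightarrow> ennreal"
  assumes [measurable]: "\<phi> \<in> borel_measurable borel" and s: "0 < s"
  shows "(\<integral>\<^sup>+x. \<phi> x \<partial>lborel) = ennreal (s ^ DIM('a)) * (\<integral>\<^sup>+x. \<phi> (s *\<^sub>R x) \<partial>lborel)"
proof -
  have "(\<integral>\<^sup>+x. \<phi> x \<partial>lborel)
    = (\<integral>\<^sup>+x. \<phi> x \<partial>density (distr lborel borel (\<lambda>x. 0 + s *\<^sub>R x)) (\<lambda>_. \<bar>s\<bar> ^ DIM('a)))"
    using s lborel_affine[of s "0 :: 'a"] by simp
  also have "\<dots> = (\<integral>\<^sup>+x. ennreal (s ^ DIM('a)) * \<phi> (s *\<^sub>R x) \<partial>lborel)"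
    using s by (simp add: nn_integral_density nn_integral_distr)
  also have "\<dots> = ennreal (s ^ DIM('a)) * (\<integral>\<^sup>+x. \<phi> (s *\<^sub>R x) \<partial>lborel)"
    by (rule nn_integral_cmult) measurable
  finally show ?thesis .
qed

lemma positive_gauge_measurable:
  fixes g :: "'a::euclidean_space \<Rightarrow> real"
  assumes "positive_gauge g"
  shows "g \<in> borel_measurable borel"
  by (intro borel_measurable_continuous_onI positive_gauge_continuous assms)

text \<open>Values in \<open>ennreal\<close> let Tonelli apply without integrability conditions.
  Degree 0 yields volumes and degree 1 first moments.\<close>

definition homogeneous :: "nat \<Rightarrow> ('a::euclidean_space \<Rightarrow> ennreal) \<Rightarrow> bool" where
  "homogeneous k \<phi> \<longleftrightarrow> \<phi> \<in> borel_measurable borel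
     \<and> (\<forall>t x. 0 < t \<longrightarrow> \<phi> (t *\<^sub>R x) = ennreal (t ^ k) * \<phi> x)"

lemma homogeneous_one: "homogeneous 0 (\<lambda>x. 1)"
  by (simp add: homogeneous_def)

text \<open>\<open>ennreal\<close> truncates negative reals to 0, so this is the positive part of the linear form.\<close>

lemma homogeneous_inner: "homogeneous 1 (\<lambda>x. ennreal (c \<bullet> x))"
  unfolding homogeneous_def by (auto simp: ennreal_mult')

lemma homogeneous_times:
  fixes a :: "'a::euclidean_space \<Rightarrow> ennreal" and b :: "'b::euclidean_space \<Rightarrow> ennreal"
  assumes "homogeneous j a" "homogeneous k b"
  shows "homogeneous (j + k) (\<lambda>w. a (fst w) * b (snd w))"
proof -
  have [measurable]: "a \<in> borel_measurable borel" "b \<in> borel_measurable borel"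
    using assms by (auto simp: homogeneous_def)
  have "(\<lambda>w. a (fst w) * b (snd w)) \<in> borel_measurable (borel \<Otimes>\<^sub>M borel)"
    by measurable
  then show ?thesis
    using assms by (auto simp: homogeneous_def borel_prod power_add ennreal_mult mult_ac)
qed

text \<open>The sublevel set is \<open>s\<close> times the unit ball; the exponent collects
  \<open>DIM('a)\<close> from the Jacobian and \<open>k\<close> from the integrand.\<close>

lemma nn_integral_gauge_sublevel:
  fixes g :: "'a::euclidean_space \<Rightarrow> real"
  assumes g: "positive_gauge g" and \<phi>: "homogeneous k \<phi>" and s: "0 < s"
  shows "(\<integral>\<^sup>+x. \<phi> x * indicator {x. g x \<le> s} x \<partial>lborel)
    = ennreal (s ^ (DIM('a) + k)) * (\<integral>\<^sup>+x. \<phi> x * indicator {x. g x \<le> 1} x \<partial>lborel)"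
proof -
  have [measurable]: "\<phi> \<in> borel_measurable borel" "g \<in> borel_measurable borel"
    using \<phi> positive_gauge_measurable[OF g] by (auto simp: homogeneous_def)
  have "(\<integral>\<^sup>+x. \<phi> x * indicator {x. g x \<le> s} x \<partial>lborel)
    = ennreal (s ^ DIM('a)) * (\<integral>\<^sup>+x. \<phi> (s *\<^sub>R x) * indicator {x. g x \<le> s} (s *\<^sub>R x) \<partial>lborel)"
    by (rule nn_integral_lborel_scale[OF _ s]) measurable
  also have "(\<integral>\<^sup>+x. \<phi> (s *\<^sub>R x) * indicator {x. g x \<le> s} (s *\<^sub>R x) \<partial>lborel)
    = (\<integral>\<^sup>+x. ennreal (s ^ k) * (\<phi> x * indicator {x. g x \<le> 1} x) \<partial>lborel)"
  proof (rule nn_integral_cong)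
    fix x
    have "indicator {x. g x \<le> s} (s *\<^sub>R x) = (indicator {x. g x \<le> 1} x :: ennreal)"
      using s positive_gaugeD(2)[OF g, of s x] by (simp add: indicator_def)
    then show "\<phi> (s *\<^sub>R x) * indicator {x. g x \<le> s} (s *\<^sub>R x)
        = ennreal (s ^ k) * (\<phi> x * indicator {x. g x \<le> 1} x)"
      using \<phi> s by (simp add: homogeneous_def mult.assoc)
  qed
  also have "\<dots> = ennreal (s ^ k) * (\<integral>\<^sup>+x. \<phi> x * indicator {x. g x \<le> 1} x \<partial>lborel)"
    by (rule nn_integral_cmult) measurable
  finally show ?thesis
    using s by (simp add: power_add ennreal_mult mult.assoc)
qed

lemma nn_integral_exp_minus_atLeast:
  "(\<integral>\<^sup>+s. ennreal (exp (- s)) * indicator {a..} s \<partial>lborel) = ennreal (exp (- a))"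
proof -
  have "((\<lambda>s :: real. exp (- 1 * s)) has_integral exp (- 1 * a) / 1) {a..}"
    by (rule has_integral_exp_minus_to_infinity) simp
  then have "(\<integral>\<^sup>+s. ennreal (indicator {a..} s * exp (- s)) \<partial>lborel) = ennreal (exp (- a))"
    by (intro nn_integral_has_integral_lebesgue) auto
  moreover have "ennreal (indicator {a..} s * exp (- s)) = ennreal (exp (- s)) * indicator {a..} s" for s
    by (auto simp: indicator_def)
  ultimately show ?thesis
    by simp
qed

text \<open>
  Write \<open>exp (- (g x powr q))\<close> as the integral of \<open>exp (- s)\<close> over \<open>s \<ge> g x powr q\<close> and exchange the integrals.
\<close>

lemma nn_integral_gauge_exp:
  fixes g :: "'a::euclidean_space \<Rightarrow> real"
  assumes g: "positive_gauge g" and \<phi>: "homogeneous k \<phi>" and q: "0 < q"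
  shows "(\<integral>\<^sup>+x. \<phi> x * ennreal (exp (- (g x powr q))) \<partial>lborel)
    = ennreal (Gamma (1 + real (DIM('a) + k) / q)) * (\<integral>\<^sup>+x. \<phi> x * indicator {x. g x \<le> 1} x \<partial>lborel)"
proof -
  have [measurable]: "\<phi> \<in> borel_measurable borel" "g \<in> borel_measurable borel"
    using \<phi> positive_gauge_measurable[OF g] by (auto simp: homogeneous_def)
  define I where "I = (\<integral>\<^sup>+x. \<phi> x * indicator {x. g x \<le> 1} x \<partial>lborel)"
  define m where "m = real (DIM('a) + k) / q"
  have m: "0 < m"
  proof -
    have "0 < DIM('a) + k"
      using DIM_positive[where 'a = 'a] by linarith
    then show ?thesis
      unfolding m_def using q by (intro divide_pos_pos) (simp_all only: of_nat_0_less_iff)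
  qed
  have "(\<integral>\<^sup>+x. \<phi> x * ennreal (exp (- (g x powr q))) \<partial>lborel)
    = (\<integral>\<^sup>+x. (\<integral>\<^sup>+s. \<phi> x * (ennreal (exp (- s)) * indicator {g x powr q..} s) \<partial>lborel) \<partial>lborel)"
    by (subst nn_integral_cmult) (auto simp: nn_integral_exp_minus_atLeast)
  also have "\<dots> = (\<integral>\<^sup>+x. (\<integral>\<^sup>+s. \<phi> x * (ennreal (exp (- s)) * indicator {z. g (fst z) powr q \<le> snd z} (x, s)) \<partial>lborel) \<partial>lborel)"
    by (simp add: indicator_def)
  also have "\<dots> = (\<integral>\<^sup>+s. (\<integral>\<^sup>+x. \<phi> x * (ennreal (exp (- s)) * indicator {z. g (fst z) powr q \<le> snd z} (x, s)) \<partial>lborel) \<partial>lborel)"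
    by (rule lborel_pair.Fubini'[symmetric]) measurable
  \<comment> \<open>The exponent keeps the form \<open>1 + m - 1\<close> to match the Euler integral
    for \<open>Gamma (1 + m)\<close>.\<close>
  also have "\<dots> = (\<integral>\<^sup>+s. ennreal (indicator {0..} s * s powr (1 + m - 1) / exp s) * I \<partial>lborel)"
  \<comment> \<open>The scaling argument needs \<open>0 < s\<close>, so the point
    \<open>s = 0\<close> is discarded as a null set.\<close>
  proof (rule nn_integral_cong_AE)
    have "AE s in lborel. s \<noteq> (0 :: real)"
      by (rule AE_lborel_singleton)
    then show "AE s in lborel. (\<integral>\<^sup>+x. \<phi> x * (ennreal (exp (- s)) * indicator {z. g (fst z) powr q \<le> snd z} (x, s)) \<partial>lborel)
        = ennreal (indicator {0..} s * s powr (1 + m - 1) / exp s) * I"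
    proof (rule AE_mp, intro AE_I2 impI)
      fix s :: real assume "s \<noteq> 0"
      then consider "s < 0" | "0 < s"
        by linarith
      then show "(\<integral>\<^sup>+x. \<phi> x * (ennreal (exp (- s)) * indicator {z. g (fst z) powr q \<le> snd z} (x, s)) \<partial>lborel)
        = ennreal (indicator {0..} s * s powr (1 + m - 1) / exp s) * I"
      proof cases
        case 1
        then have "\<not> g x powr q \<le> s" for x
          using powr_ge_zero[of "g x" q] by linarith
        then show ?thesis
          using 1 by simp
      next
        case 2
        have iff: "g x powr q \<le> s \<longleftrightarrow> g x \<le> s powr (1 / q)" for x
        proof
          assume "g x powr q \<le> s"
          then have "(g x powr q) powr (1 / q) \<le> s powr (1 / q)"
            using q by (intro powr_mono2) auto
          then show "g x \<le> s powr (1 / q)"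
            using q positive_gaugeD(5)[OF g] by (simp add: powr_powr)
        next
          assume "g x \<le> s powr (1 / q)"
          then have "g x powr q \<le> (s powr (1 / q)) powr q"
            using q positive_gaugeD(5)[OF g] by (intro powr_mono2) auto
          then show "g x powr q \<le> s"
            using q 2 by (simp add: powr_powr)
        qed
        have "(\<integral>\<^sup>+x. \<phi> x * (ennreal (exp (- s)) * indicator {z. g (fst z) powr q \<le> snd z} (x, s)) \<partial>lborel)
          = (\<integral>\<^sup>+x. ennreal (exp (- s)) * (\<phi> x * indicator {x. g x \<le> s powr (1 / q)} x) \<partial>lborel)"
          by (intro nn_integral_cong) (auto simp: indicator_def iff mult.commute)
        also have "\<dots> = ennreal (exp (- s)) * (\<integral>\<^sup>+x. \<phi> x * indicator {x. g x \<le> s powr (1 / q)} x \<partial>lborel)"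
          by (rule nn_integral_cmult) measurable
        also have "\<dots> = ennreal (exp (- s)) * (ennreal ((s powr (1 / q)) ^ (DIM('a) + k)) * I)"
          unfolding I_def using 2 by (subst nn_integral_gauge_sublevel[OF g \<phi>]) auto
        also have "(s powr (1 / q)) ^ (DIM('a) + k) = s powr m"
          using 2 by (simp add: m_def powr_powr flip: powr_realpow)
        also have "ennreal (exp (- s)) * (ennreal (s powr m) * I)
          = ennreal (indicator {0..} s * s powr (1 + m - 1) / exp s) * I"
          using 2 by (simp add: exp_minus field_simps flip: mult.assoc ennreal_mult')
        finally show ?thesis .
      qed
    qed
  qed
  also have "\<dots> = (\<integral>\<^sup>+s. ennreal (indicator {0..} s * s powr (1 + m - 1) / exp s) \<partial>lborel) * I"
    by (rule nn_integral_multc) measurable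
  also have "(\<integral>\<^sup>+s. ennreal (indicator {0..} s * s powr (1 + m - 1) / exp s) \<partial>lborel) = ennreal (Gamma (1 + m))"
    using Gamma_conv_nn_integral_real[of "1 + m"] m by simp
  finally show ?thesis
    unfolding I_def m_def .
qed

section \<open>Volume and first moments of the l_p product ball\<close>

lemma Gamma_one_plus_over_exponent_pos:
  assumes "1 \<le> p" "0 \<le> r"
  shows "0 < Gamma (1 + over_exponent r p)"
  using assms by (cases p) (auto intro!: Gamma_real_pos add_pos_nonneg simp: over_exponent_def)

lemma nn_integral_lborel_times:
  fixes a :: "'a::euclidean_space \<Rightarrow> ennreal" and b :: "'b::euclidean_space \<Rightarrow> ennreal"
  assumes [measurable]: "a \<in> borel_measurable borel" "b \<in> borel_measurable borel"
  shows "(\<integral>\<^sup>+w. a (fst w) * b (snd w) \<partial>lborel) = (\<integral>\<^sup>+x. a x \<partial>lborel) * (\<integral>\<^sup>+y. b y \<partial>lborel)"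
proof -
  have "(\<integral>\<^sup>+w. a (fst w) * b (snd w) \<partial>lborel) = (\<integral>\<^sup>+w. a (fst w) * b (snd w) \<partial>(lborel \<Otimes>\<^sub>M lborel))"
    by (simp add: lborel_prod)
  also have "\<dots> = (\<integral>\<^sup>+x. \<integral>\<^sup>+y. a x * b y \<partial>lborel \<partial>lborel)"
    by (subst lborel.nn_integral_fst[symmetric]) auto
  also have "\<dots> = (\<integral>\<^sup>+x. a x \<partial>lborel) * (\<integral>\<^sup>+y. b y \<partial>lborel)"
    by (simp add: nn_integral_cmult nn_integral_multc)
  finally show ?thesis .
qed

text \<open>Each passage between a unit ball and an exponential weight costs one Gamma factor, whose
  argument records dimension plus degree; the whole ball contributes one and the two factors one
  each. For infinite \<open>p\<close> the ball is a product and every Gamma factor is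
  \<open>Gamma 1 = 1\<close>.\<close>

lemma nn_integral_lp_product:
  fixes f :: "'a::euclidean_space \<Rightarrow> real" and g :: "'b::euclidean_space \<Rightarrow> real"
  assumes f: "positive_gauge f" and g: "positive_gauge g" and p: "1 \<le> p"
    and a: "homogeneous j a" and b: "homogeneous k b"
  shows "ennreal (Gamma (1 + over_exponent (real (DIM('a) + DIM('b) + j + k)) p))
      * (\<integral>\<^sup>+w. a (fst w) * b (snd w)
           * indicator {w. lp_combination p (f (fst w)) (g (snd w)) \<le> 1} w \<partial>lborel)
    = ennreal (Gamma (1 + over_exponent (real (DIM('a) + j)) p))
      * ennreal (Gamma (1 + over_exponent (real (DIM('b) + k)) p))
      * ((\<integral>\<^sup>+x. a x * indicator {x. f x \<le> 1} x \<partial>lborel)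
         * (\<integral>\<^sup>+y. b y * indicator {y. g y \<le> 1} y \<partial>lborel))"
proof -
  have [measurable]: "f \<in> borel_measurable borel" "g \<in> borel_measurable borel"
    "a \<in> borel_measurable borel" "b \<in> borel_measurable borel"
    using f g a b by (auto simp: homogeneous_def positive_gauge_measurable)
  show ?thesis
  proof (cases "p = \<infinity>")
    case True
    have "(\<integral>\<^sup>+w. a (fst w) * b (snd w)
           * indicator {w. lp_combination p (f (fst w)) (g (snd w)) \<le> 1} w \<partial>lborel)
      = (\<integral>\<^sup>+w. (a (fst w) * indicator {x. f x \<le> 1} (fst w)) * (b (snd w) * indicator {y. g y \<le> 1} (snd w)) \<partial>lborel)"
      using True by (intro nn_integral_cong) (auto simp: lp_combination_def indicator_def)
    also have "\<dots> = (\<integral>\<^sup>+x. a x * indicator {x. f x \<le> 1} x \<partial>lborel)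
         * (\<integral>\<^sup>+y. b y * indicator {y. g y \<le> 1} y \<partial>lborel)"
      by (rule nn_integral_lborel_times) measurable
    finally show ?thesis
      using True by (simp add: over_exponent_def)
  next
    case False
    then obtain q where q: "p = ereal q" "1 \<le> q"
      using p by (cases p) auto
    define N where "N w = lp_combination p (f (fst w)) (g (snd w))" for w
    have N: "positive_gauge N"
      unfolding N_def by (rule positive_gauge_lp_combination[OF f g p])
    have ab: "homogeneous (j + k) (\<lambda>w. a (fst w) * b (snd w))"
      by (rule homogeneous_times[OF a b])
    have "ennreal (Gamma (1 + real (DIM('a \<times> 'b) + (j + k)) / q))
        * (\<integral>\<^sup>+w. a (fst w) * b (snd w) * indicator {w. N w \<le> 1} w \<partial>lborel)
      = (\<integral>\<^sup>+w. a (fst w) * b (snd w) * ennreal (exp (- (N w powr q))) \<partial>lborel)"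
      by (rule nn_integral_gauge_exp[OF N ab, symmetric]) (use q in simp)
    also have "\<dots> = (\<integral>\<^sup>+w. (a (fst w) * ennreal (exp (- (f (fst w) powr q))))
        * (b (snd w) * ennreal (exp (- (g (snd w) powr q)))) \<partial>lborel)"
    proof (rule nn_integral_cong)
      fix w :: "'a \<times> 'b"
      have "N w powr q = f (fst w) powr q + g (snd w) powr q"
        unfolding N_def q(1) by (rule lp_combination_finite(1)[OF q(2) positive_gaugeD(5)[OF f] positive_gaugeD(5)[OF g]])
      then have "ennreal (exp (- (N w powr q)))
        = ennreal (exp (- (f (fst w) powr q))) * ennreal (exp (- (g (snd w) powr q)))"
        by (simp add: exp_add[symmetric] flip: ennreal_mult')
      then show "a (fst w) * b (snd w) * ennreal (exp (- (N w powr q)))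
        = (a (fst w) * ennreal (exp (- (f (fst w) powr q)))) * (b (snd w) * ennreal (exp (- (g (snd w) powr q))))"
        by (simp add: mult_ac)
    qed
    also have "\<dots> = (\<integral>\<^sup>+x. a x * ennreal (exp (- (f x powr q))) \<partial>lborel)
        * (\<integral>\<^sup>+y. b y * ennreal (exp (- (g y powr q))) \<partial>lborel)"
      by (rule nn_integral_lborel_times) measurable
    also have "\<dots> = (ennreal (Gamma (1 + real (DIM('a) + j) / q)) * (\<integral>\<^sup>+x. a x * indicator {x. f x \<le> 1} x \<partial>lborel))
        * (ennreal (Gamma (1 + real (DIM('b) + k) / q)) * (\<integral>\<^sup>+y. b y * indicator {y. g y \<le> 1} y \<partial>lborel))"
      using q by (subst (1 2) nn_integral_gauge_exp) (use f g a b in auto)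
    finally show ?thesis
      using q by (simp add: over_exponent_def N_def add_ac mult_ac)
  qed
qed

text \<open>The negative part of a linear form is the positive part of the form for
  \<open>- c\<close>, so signed moments reduce to nonnegative homogeneous integrands.\<close>

lemma lebesgue_integral_inner_compact:
  fixes h :: "'a::euclidean_space \<Rightarrow> 'b::euclidean_space"
  assumes S: "compact S" and h: "continuous_on S h"
  shows "(LINT x:S|lborel. c \<bullet> h x)
    = enn2real (\<integral>\<^sup>+x. ennreal (c \<bullet> h x) * indicator S x \<partial>lborel)
      - enn2real (\<integral>\<^sup>+x. ennreal ((- c) \<bullet> h x) * indicator S x \<partial>lborel)"
proof -
  have "integrable lborel (\<lambda>x. indicator S x *\<^sub>R (c \<bullet> h x))"
    by (intro borel_integrable_compact S continuous_intros h)
  then have "(LINT x:S|lborel. c \<bullet> h x)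
    = enn2real (\<integral>\<^sup>+x. ennreal (indicator S x *\<^sub>R (c \<bullet> h x)) \<partial>lborel)
      - enn2real (\<integral>\<^sup>+x. ennreal (- (indicator S x *\<^sub>R (c \<bullet> h x))) \<partial>lborel)"
    unfolding set_lebesgue_integral_def by (rule real_lebesgue_integral_def)
  moreover have "ennreal (indicator S x *\<^sub>R (c \<bullet> h x)) = ennreal (c \<bullet> h x) * indicator S x"
    "ennreal (- (indicator S x *\<^sub>R (c \<bullet> h x))) = ennreal ((- c) \<bullet> h x) * indicator S x" for x
    by (auto simp: indicator_def)
  ultimately show ?thesis
    by simp
qed

text \<open>The barycenter hypothesis is vectorial and stated over \<open>lebesgue\<close>; this is
  its scalar form over \<open>lborel\<close>, where positive volume cancels the
  normalization.\<close>

lemma inner_barycenter: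
  fixes S :: "(real ^ 'n) set"
  assumes S: "compact S" and pos: "0 < measure lborel S"
  shows "(LINT x:S|lborel. c \<bullet> x) = measure lborel S * (c \<bullet> barycenter S)"
proof -
  have [measurable]: "S \<in> sets borel"
    using S by (rule borel_compact)
  have int: "integrable lborel (\<lambda>x. indicator S x *\<^sub>R x)"
    by (intro borel_integrable_compact S continuous_intros)
  have "(LINT x:S|lborel. c \<bullet> x) = c \<bullet> (LINT x:S|lborel. x)"
    using integral_inner_right[of c lborel "\<lambda>x. indicator S x *\<^sub>R x"] int
    by (simp add: set_lebesgue_integral_def)
  also have "(LINT x:S|lborel. x) = (LINT x:S|lebesgue. x)"
    unfolding set_lebesgue_integral_def by (rule integral_completion[symmetric]) measurable
  also have "\<dots> = measure lborel S *\<^sub>R barycenter S"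
    using pos by (simp add: barycenter_def)
  finally show ?thesis
    by simp
qed

lemma enn2real_indicator_compact:
  fixes S :: "'a::euclidean_space set"
  assumes "compact S"
  shows "enn2real (\<integral>\<^sup>+x. indicator S x \<partial>lborel) = measure lborel S"
  using assms by (simp add: borel_compact measure_def)

context
  fixes f :: "'a::euclidean_space \<Rightarrow> real" and g :: "'b::euclidean_space \<Rightarrow> real" and p :: ereal
  assumes f: "positive_gauge f" and g: "positive_gauge g" and p: "1 \<le> p"
begin

abbreviation (input) lp_ball :: "('a \<times> 'b) set" where
  "lp_ball \<equiv> {w. lp_combination p (f (fst w)) (g (snd w)) \<le> 1}"

abbreviation (input) \<gamma> :: "nat \<Rightarrow> real" where
  "\<gamma> d \<equiv> Gamma (1 + over_exponent (real d) p)"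

lemma compact_lp_ball: "compact lp_ball"
  by (rule positive_gauge_le_1(1)[OF positive_gauge_lp_combination[OF f g p]])

text \<open>\<open>enn2real\<close> is multiplicative even at infinity, and the Gamma values are
  positive, so the identity passes to the reals as it stands.\<close>

lemma enn2real_lp_product:
  assumes a: "homogeneous j a" and b: "homogeneous k b"
  shows "\<gamma> (DIM('a) + DIM('b) + j + k)
      * enn2real (\<integral>\<^sup>+w. a (fst w) * b (snd w) * indicator lp_ball w \<partial>lborel)
    = \<gamma> (DIM('a) + j) * \<gamma> (DIM('b) + k)
      * (enn2real (\<integral>\<^sup>+x. a x * indicator {x. f x \<le> 1} x \<partial>lborel)
         * enn2real (\<integral>\<^sup>+y. b y * indicator {y. g y \<le> 1} y \<partial>lborel))"
  using arg_cong[OF nn_integral_lp_product[OF f g p a b], of enn2real]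
    Gamma_one_plus_over_exponent_pos[OF p, of "real (DIM('a) + DIM('b) + j + k)"]
    Gamma_one_plus_over_exponent_pos[OF p, of "real (DIM('a) + j)"]
    Gamma_one_plus_over_exponent_pos[OF p, of "real (DIM('b) + k)"]
  by (simp add: enn2real_mult)

text \<open>Degree 0 in both variables. With equal dimensions this is the source of the constant in
  the theorem.\<close>

lemma measure_lp_ball:
  "\<gamma> (DIM('a) + DIM('b)) * measure lborel lp_ball
    = \<gamma> DIM('a) * \<gamma> DIM('b) * (measure lborel {x. f x \<le> 1} * measure lborel {y. g y \<le> 1})"
  using enn2real_lp_product[OF homogeneous_one homogeneous_one]
    enn2real_indicator_compact[OF compact_lp_ball]
    enn2real_indicator_compact[OF positive_gauge_le_1(1)[OF f]]
    enn2real_indicator_compact[OF positive_gauge_le_1(1)[OF g]]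
  by simp

text \<open>Degree 1 in the first variable and 0 in the second, taken for \<open>c\<close> and for
  \<open>- c\<close> and subtracted. The linear weight raises only the Gamma arguments of the first
  factor and of the whole ball.\<close>

lemma lp_ball_moment_fst:
  "\<gamma> (DIM('a) + DIM('b) + 1) * (LINT w:lp_ball|lborel. c \<bullet> fst w)
    = \<gamma> (DIM('a) + 1) * \<gamma> DIM('b) * ((LINT x:{x. f x \<le> 1}|lborel. c \<bullet> x) * measure lborel {y. g y \<le> 1})"
proof -
  have "continuous_on lp_ball fst" "continuous_on {x. f x \<le> 1} (\<lambda>x. x)"
    by (intro continuous_intros)+
  note moments = lebesgue_integral_inner_compact[OF compact_lp_ball this(1)]
    lebesgue_integral_inner_compact[OF positive_gauge_le_1(1)[OF f] this(2)]
  show ?thesis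
    using enn2real_lp_product[OF homogeneous_inner[of c] homogeneous_one]
      enn2real_lp_product[OF homogeneous_inner[of "- c"] homogeneous_one]
      enn2real_indicator_compact[OF positive_gauge_le_1(1)[OF g]]
    unfolding moments by (simp add: algebra_simps)
qed

lemma lp_ball_moment_snd:
  "\<gamma> (DIM('a) + DIM('b) + 1) * (LINT w:lp_ball|lborel. c \<bullet> snd w)
    = \<gamma> DIM('a) * \<gamma> (DIM('b) + 1) * (measure lborel {x. f x \<le> 1} * (LINT y:{y. g y \<le> 1}|lborel. c \<bullet> y))"
proof -
  have "continuous_on lp_ball snd" "continuous_on {y. g y \<le> 1} (\<lambda>y. y)"
    by (intro continuous_intros)+
  note moments = lebesgue_integral_inner_compact[OF compact_lp_ball this(1)]
    lebesgue_integral_inner_compact[OF positive_gauge_le_1(1)[OF g] this(2)]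
  show ?thesis
    using enn2real_lp_product[OF homogeneous_one homogeneous_inner[of c]]
      enn2real_lp_product[OF homogeneous_one homogeneous_inner[of "- c"]]
      enn2real_indicator_compact[OF positive_gauge_le_1(1)[OF f]]
    unfolding moments by (simp add: algebra_simps)
qed

end

section \<open>The inequality\<close>

lemma support_function_uminus: "support_function (uminus ` L) x = support_function L (- x)"
  by (simp add: support_function_def image_image)

lemma measure_lebesgue_compact:
  "compact S \<Longrightarrow> measure lebesgue S = measure lborel (S :: 'a::euclidean_space set)"
  by (simp add: borel_compact)

theorem theorem1p2:
  fixes K L :: "(real ^ 'n) set" and p :: ereal
  assumes "convex_body K" and "convex_body L"
    and "0 \<in> interior K \<inter> interior L"
    and "barycenter (polar_body K) = - barycenter (polar_body L)"
    and "1 \<le> p"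
  shows "measure lebesgue (polar_body (lp_intersection p K L))
           * measure lebesgue (polar_body (lp_sum p K (uminus ` L)))
         \<ge> (Gamma (1 + over_exponent (real CARD('n)) p))\<^sup>2
             / Gamma (1 + over_exponent (2 * real CARD('n)) p)
           * measure lebesgue (polar_body K) * measure lebesgue (polar_body L)"
proof -
  define f where "f = support_function K"
  define g where "g = support_function L"
  have f: "positive_gauge f" and g: "positive_gauge g"
    using assms(1-3) by (auto simp: f_def g_def intro: positive_gauge_support_function)
  define N where "N w = lp_combination p (f (fst w)) (g (snd w))" for w
  have N: "positive_gauge N"
    unfolding N_def using f g assms(5) by (rule positive_gauge_lp_combination)
  define A where "A = {x. f x \<le> 1}"
  define B where "B = {x. g x \<le> 1}"
  define D where "D = {w. N w \<le> 1}"
  have polar: "polar_body K = A" "polar_body L = B"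
    using polar_body_eq assms(1,2) by (simp_all add: A_def B_def f_def g_def)
  have cA: "compact A" and cB: "compact B" and D: "compact D" "convex D" "0 \<in> interior D"
    using positive_gauge_le_1 f g N unfolding A_def B_def D_def by blast+
  \<comment> \<open>Positive volume is what allows moments to be recovered from barycenters.\<close>
  have pos: "0 < measure lborel {x. h x \<le> 1}" if h: "positive_gauge h" for h :: "real ^ 'n \<Rightarrow> real"
  proof -
    have "0 < measure lborel (interior {x. h x \<le> 1})"
      using positive_gauge_le_1[OF h]
      by (intro measure_open_pos fmeasurable_lborelI)
         (auto intro: bounded_subset[OF _ interior_subset] compact_imp_bounded)
    then show ?thesis
      using measure_interior_compact_convex[OF positive_gauge_le_1(1,2)[OF h]] by simp
  qed
  have posA: "0 < measure lborel A" and posB: "0 < measure lborel B"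
    using pos f g by (auto simp: A_def B_def)
  let ?\<gamma> = "\<lambda>d. Gamma (1 + over_exponent (real d) p)"
  have \<gamma>: "0 < ?\<gamma> d" for d
    by (rule Gamma_one_plus_over_exponent_pos[OF assms(5)]) simp
  have volume: "?\<gamma> (CARD('n) + CARD('n)) * measure lborel D
      = ?\<gamma> CARD('n) * ?\<gamma> CARD('n) * (measure lborel A * measure lborel B)"
    using measure_lp_ball[OF f g assms(5)] by (simp add: D_def N_def A_def B_def)
  have "(LINT w:D|lborel. c \<bullet> (fst w + snd w)) = 0" for c
  proof -
    have int: "set_integrable lborel D (\<lambda>w. c \<bullet> fst w)" "set_integrable lborel D (\<lambda>w. c \<bullet> snd w)"
      unfolding set_integrable_def by (intro borel_integrable_compact D continuous_intros)+
    have "(LINT w:D|lborel. c \<bullet> (fst w + snd w)) = (LINT w:D|lborel. c \<bullet> fst w) + (LINT w:D|lborel. c \<bullet> snd w)"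
      using set_integral_add(2)[OF int] by (simp add: inner_add_right)
    \<comment> \<open>The moment formulas carry this Gamma factor on the left; it is multiplied in
      here and cancelled at the end by positivity.\<close>
    then have "?\<gamma> (CARD('n) + CARD('n) + 1) * (LINT w:D|lborel. c \<bullet> (fst w + snd w))
      = ?\<gamma> (CARD('n) + CARD('n) + 1) * (LINT w:D|lborel. c \<bullet> fst w)
        + ?\<gamma> (CARD('n) + CARD('n) + 1) * (LINT w:D|lborel. c \<bullet> snd w)"
      by (simp only: distrib_left)
    also have "\<dots> = ?\<gamma> (CARD('n) + 1) * ?\<gamma> CARD('n) * ((LINT x:A|lborel. c \<bullet> x) * measure lborel B)
        + ?\<gamma> CARD('n) * ?\<gamma> (CARD('n) + 1) * (measure lborel A * (LINT x:B|lborel. c \<bullet> x))"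
      using lp_ball_moment_fst[OF f g assms(5), of c] lp_ball_moment_snd[OF f g assms(5), of c]
      by (simp only: D_def N_def A_def B_def DIM_cart DIM_real mult_1_right)
    \<comment> \<open>Both moments have the same coefficient because \<open>A\<close> and
      \<open>B\<close> have the same dimension, so the sum is a multiple of
      \<open>c \<bullet> (barycenter A + barycenter B)\<close>.\<close>
    also have "\<dots> = 0"
      using assms(4) inner_barycenter[OF cA posA, of c] inner_barycenter[OF cB posB, of c]
      by (simp add: polar)
    finally show ?thesis
      using \<gamma>[of "CARD('n) + CARD('n) + 1"] by simp
  qed
  then have spingarn: "measure lborel D
      \<le> measure lborel {x. (x, - x) \<in> D} * measure lborel ((\<lambda>w. fst w + snd w) ` D)"
    by (rule spingarn_inequality_sum[OF D])
  define h where "h z = Inf {N (x1, x2) | x1 x2. x1 + x2 = z}" for z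
  have h: "positive_gauge h"
    unfolding h_def by (rule positive_gauge_inf_convolution[OF N])
  have "lp_sum p K (uminus ` L) = body_with_support (\<lambda>x. N (x, - x))"
    by (simp add: lp_sum_def support_function_uminus N_def f_def g_def)
  then have sum: "polar_body (lp_sum p K (uminus ` L)) = {x. (x, - x) \<in> D}"
    by (simp add: polar_body_with_support[OF positive_gauge_antidiagonal[OF N]] D_def)
  have "lp_intersection p K L = body_with_support h"
    by (simp add: lp_intersection_def h_def[abs_def] N_def f_def g_def)
  then have inter: "polar_body (lp_intersection p K L) = {z. h z \<le> 1}"
    by (simp add: polar_body_with_support[OF h])
  \<comment> \<open>A pair in \<open>D\<close> is an admissible decomposition of its sum, so the
    infimum \<open>h\<close> is at most 1 on the image.\<close>
  have "measure lborel ((\<lambda>w. fst w + snd w) ` D) \<le> measure lborel {z. h z \<le> 1}"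
  proof (rule measure_mono_fmeasurable)
    show "(\<lambda>w. fst w + snd w) ` D \<subseteq> {z. h z \<le> 1}"
    proof (rule image_subsetI)
      fix w assume "w \<in> D"
      then have "N w \<le> 1"
        by (simp add: D_def)
      moreover have "h (fst w + snd w) \<le> N w"
        using inf_convolution_le[OF N, of "fst w" "snd w"] by (simp add: h_def)
      ultimately show "fst w + snd w \<in> {z. h z \<le> 1}"
        by simp
    qed
    show "(\<lambda>w. fst w + snd w) ` D \<in> sets lborel"
      using D(1) by (auto intro!: borel_compact compact_continuous_image continuous_intros)
    show "{z. h z \<le> 1} \<in> fmeasurable lborel"
      using positive_gauge_le_1(1)[OF h]
      by (auto intro!: fmeasurable_lborelI borel_compact compact_imp_bounded)
  qed
  then have "measure lborel D \<le> measure lborel {x. (x, - x) \<in> D} * measure lborel {z. h z \<le> 1}"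
    using spingarn by (meson measure_nonneg mult_left_mono order_trans)
  moreover have "compact {x. (x, - x) \<in> D}"
    using positive_gauge_le_1(1)[OF positive_gauge_antidiagonal[OF N]] by (simp add: D_def)
  moreover have "measure lborel D = (?\<gamma> CARD('n))\<^sup>2 / ?\<gamma> (CARD('n) + CARD('n)) * measure lborel A * measure lborel B"
    using volume \<gamma>[of "CARD('n) + CARD('n)"] by (simp add: field_simps power2_eq_square)
  ultimately show ?thesis
    using cA cB positive_gauge_le_1(1)[OF h]
    by (simp add: polar sum inter measure_lebesgue_compact mult.commute)
qed

end
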